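(* Let $F_\infty=(F_n)_{n\ge 1}$ be an exchangeable, consistent, regular random feature allocation of $\mathbb{N}$. Then there exists a random sequence $(C_k)_{k=1}^{\infty}$ such that each $C_k$ is a countable union of subintervals of $[0,1]$ (possibly empty), and such that $F_\infty$ has the same distribution as the random feature allocation $F'_\infty$ generated as follows: let $(U'_n)_{n\ge1}$ be iid uniform on $[0,1]$, independent of $(C_k)_{k\ge1}$; let $Z_n:=\{k: U'_n\in C_k\}$ be the collection of feature labels of index $n$; and let $F'_\infty$ be the feature allocation induced by the label collections $(Z_n)_{n\ge1}$.
   Context: Let $[N]=\{1,\dots,N\}$. Feature allocation: a feature allocation of $[N]$ (or of $\mathbb{N}$) is a multiset of non-empty subsets of $[N]$ (resp. $\mathbb{N}$), called features, such that no index $n$ belongs to infinitely many features (counted with multiplicity). The empty multiset is allowed. For $M<N$, the restriction of a feature allocation $f_N$ of $[N]$ to $[M]$ is the multiset $\{A\cap[M]: A\in f_N,\ A\cap[M]\ne\emptyset\}$ (with multiplicities). Random feature allocation: a random feature allocation of $[N]$ is a random element of the (countable) set of feature allocations of $[N]$. A random feature allocation $F_\infty$ of $\mathbb{N}$ is a sequence $(F_n)_{n\ge1}$ of random feature allocations, $F_n$ of $[n]$, that is consistent: for all $M<N$, almost surely $F_M$ is the restriction of $F_N$ to $[M]$. Such a sequence is identified with the corresponding random multiset of subsets of $\mathbb{N}$; its distribution is its law on the $\sigma$-field generated by all $F_n$. Exchangeability: for a permutation $\sigma$ of the indices, $\sigma(A)=\{\sigma(n):n\in A\}$ and $\sigma$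 acts on a feature allocation by acting on each of its features. $F_\infty$ is exchangeable if for every $N$ and every permutation $\sigma$ of $[N]$, $F_N$ and $\sigma(F_N)$ have the same distribution. Regularity: $F_\infty$ is regular if for each $n$, with probability one there exists $m\ne n$ such that $m$ and $n$ belong to exactly the same features of $F_\infty$ (the features being treated as distinguishable, so that repeated copies of the same set are distinct features). Induced feature allocation: given label collections $(Z_n)_{n\ge1}$, the induced feature allocation is the multiset of the non-empty sets among $\{n: k\in Z_n\}$, $k=1,2,\dots$ (one copy for each label $k$ whose set is non-empty). "Random sequence $(C_k)$" is understood in the sense that the events $\{U'_n\in C_k\}$ are measurable. *)

theory Defs
  imports "HOL-Probability.Probability" "HOL-Combinatorics.Permutations"
begin

(* Every feature of [N] contains one of finitely many indices, so the requirement that no index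
   lie in infinitely many features says exactly that the multiset is finite. *)
definition feature_allocations :: "nat \<Rightarrow> nat set multiset set" where
  "feature_allocations N = {f. \<forall>A\<in>#f. A \<noteq> {} \<and> A \<subseteq> {1..N}}"

definition restrict_alloc :: "nat \<Rightarrow> nat set multiset \<Rightarrow> nat set multiset" where
  "restrict_alloc m f = filter_mset (\<lambda>A. A \<noteq> {}) (image_mset (\<lambda>A. A \<inter> {1..m}) f)"

(* An allocation of {1,2,...} may have infinitely many features. It is encoded by its multiplicity
   function g; multiplicities are finite since a non-empty set of infinite multiplicity would put
   its elements into infinitely many features. The pair (A, i) is the i-th copy of A. *)
definition features :: "(nat set \<Rightarrow> nat) \<Rightarrow> (nat set \<times> nat) set" where
  "features g = {(A, i). i < g A}"

definition features_of :: "(nat set \<Rightarrow> nat) \<Rightarrow> nat \<Rightarrow> (nat set \<times> nat) set" where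
  "features_of g n = {x \<in> features g. n \<in> fst x}"

definition inf_feature_allocation :: "(nat set \<Rightarrow> nat) \<Rightarrow> bool" where
  "inf_feature_allocation g \<longleftrightarrow>
     (\<forall>(A, i) \<in> features g. A \<noteq> {} \<and> A \<subseteq> {1..}) \<and> (\<forall>n\<ge>1. finite (features_of g n))"

(* For allocations satisfying inf_feature_allocation the set under mset_set is finite. *)
definition inf_restrict_alloc :: "nat \<Rightarrow> (nat set \<Rightarrow> nat) \<Rightarrow> nat set multiset" where
  "inf_restrict_alloc m g =
     image_mset (\<lambda>x. fst x \<inter> {1..m}) (mset_set {x \<in> features g. fst x \<inter> {1..m} \<noteq> {}})"

(* A consistent sequence f determines g uniquely; this is the identification of a consistent
   sequence of allocations of the [n] with a multiset of subsets of {1,2,...}. *)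
definition represents :: "(nat set \<Rightarrow> nat) \<Rightarrow> (nat \<Rightarrow> nat set multiset) \<Rightarrow> bool" where
  "represents g f \<longleftrightarrow> inf_feature_allocation g \<and> (\<forall>n\<ge>1. f n = inf_restrict_alloc n g)"

definition random_feature_allocation ::
  "'w measure \<Rightarrow> (nat \<Rightarrow> 'w \<Rightarrow> nat set multiset) \<Rightarrow> bool" where
  "random_feature_allocation M F \<longleftrightarrow>
     (\<forall>n\<ge>1. F n \<in> measurable M (count_space (feature_allocations n))) \<and>
     (\<forall>m n. 1 \<le> m \<and> m < n \<longrightarrow> (AE w in M. F m w = restrict_alloc m (F n w)))"

definition alloc_law ::
  "'w measure \<Rightarrow> (nat \<Rightarrow> 'w \<Rightarrow> nat set multiset) \<Rightarrow> (nat \<Rightarrow> nat set multiset) measure" where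
  "alloc_law M F = distr M (PiM {1..} (\<lambda>n. count_space (feature_allocations n)))
                     (\<lambda>w. \<lambda>n\<in>{1..}. F n w)"

definition exchangeable :: "'w measure \<Rightarrow> (nat \<Rightarrow> 'w \<Rightarrow> nat set multiset) \<Rightarrow> bool" where
  "exchangeable M F \<longleftrightarrow>
     (\<forall>N\<ge>1. \<forall>\<sigma>. \<sigma> permutes {1..N} \<longrightarrow>
        distr M (count_space (feature_allocations N)) (F N) =
        distr M (count_space (feature_allocations N)) (\<lambda>w. image_mset (\<lambda>A. \<sigma> ` A) (F N w)))"

definition regular_alloc :: "'w measure \<Rightarrow> (nat \<Rightarrow> 'w \<Rightarrow> nat set multiset) \<Rightarrow> bool" where
  "regular_alloc M F \<longleftrightarrow>
     (\<forall>n\<ge>1. AE w in M. \<exists>g. represents g (\<lambda>j. F j w) \<and>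
        (\<exists>m\<ge>1. m \<noteq> n \<and> features_of g m = features_of g n))"

definition label_set :: "(nat \<Rightarrow> 'v \<Rightarrow> real set) \<Rightarrow> (nat \<Rightarrow> 'v \<Rightarrow> real) \<Rightarrow> 'v \<Rightarrow> nat \<Rightarrow> nat set" where
  "label_set C U w n = {k. k \<ge> 1 \<and> U n w \<in> C k w}"

(* If every Z n is finite, then so is the set under card, for every non-empty A. *)
definition induced_alloc :: "(nat \<Rightarrow> nat set) \<Rightarrow> nat set \<Rightarrow> nat" where
  "induced_alloc Z A = (if A = {} then 0 else card {k. k \<ge> 1 \<and> {n. n \<ge> 1 \<and> k \<in> Z n} = A})"

definition countable_union_of_intervals :: "real set \<Rightarrow> bool" where
  "countable_union_of_intervals S \<longleftrightarrow>
     (\<exists>I :: nat \<Rightarrow> real set. (\<forall>j. is_interval (I j) \<and> I j \<subseteq> {0..1}) \<and> S = (\<Union>j. I j))"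

definition iid_uniform :: "'v measure \<Rightarrow> (nat \<Rightarrow> 'v \<Rightarrow> real) \<Rightarrow> bool" where
  "iid_uniform M U \<longleftrightarrow>
     prob_space.indep_vars M (\<lambda>_. borel) U {1..} \<and>
     (\<forall>n\<ge>1. distr M borel (U n) = uniform_measure lborel {0..1})"

(* The random sets C k are jointly measurable with respect to some sub-sigma-algebra G that is
   independent of (U n). Joint measurability in (w, x) makes the events {U n : C k} measurable.
   Requiring independence only of the sigma-algebra generated by the events {x : C k} for fixed x
   would be too weak: C 1 = {U 1} is "independent" of U 1 in that sense. *)
definition random_sets_indep ::
  "'v measure \<Rightarrow> (nat \<Rightarrow> 'v \<Rightarrow> real set) \<Rightarrow> (nat \<Rightarrow> 'v \<Rightarrow> real) \<Rightarrow> bool" where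
  "random_sets_indep M C U \<longleftrightarrow>
     (\<exists>G. subalgebra M G \<and>
        (\<forall>k\<ge>1. {(w, x). w \<in> space G \<and> x \<in> C k w} \<in> sets (G \<Otimes>\<^sub>M borel)) \<and>
        prob_space.indep_set M (sets G)
          (sets (vimage_algebra (space M) (\<lambda>w. \<lambda>n\<in>{1..}. U n w) (PiM {1..} (\<lambda>_. borel)))))"

end

theory Submission imports Defs begin

text \<open>
  The theorem is a Kingman-type representation, and it is proved by sampling with replacement,
  without de Finetti's theorem.

  Label the features of the allocation measurably by natural numbers, and let \<open>Z j\<close> be the finite set
  of labels of index \<open>j\<close>, so that \<open>F n\<close> is the allocation induced by \<open>Z 1, ..., Z n\<close>
  (\<open>f_eq_alloc_of\<close>). Exchangeability says that \<open>Z (i 1), ..., Z (i N)\<close> induces an allocation with the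
  law of \<open>F N\<close> for every injective choice of indices \<open>i\<close> (\<open>prob_reindex\<close>). Indices with equal label
  sets form blocks. The frequency of each block in \<open>{1..4^k}\<close> converges almost surely as \<open>k\<close> grows, by
  a second moment estimate for averages of exchangeable indicators (\<open>averages_converge\<close>). Regularity
  says that the probability that index \<open>r + 1\<close> falls into the block of one of the indices \<open>1, ..., r\<close>
  tends to 1, and this forces the limit frequencies of the blocks to sum to 1
  (\<open>AE_mass_sums_1\<close>).

  Given the allocation, cut the unit interval into consecutive intervals, one for each block, whose
  lengths are the limit frequencies, and let \<open>C k\<close> be the union of the intervals of those blocks whose
  indices carry the label \<open>k\<close>. A uniform point then chooses a block according to its limit frequency.
  Choosing \<open>N\<close> indices uniformly and independently from \<open>{1..4^k}\<close> induces an allocation whose law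
  is that of \<open>F N\<close> up to the probability of a repeated index, which is at most \<open>N^2 / 4^k\<close>; the
  chosen blocks have the empirical frequencies, which tend to the limit frequencies. Truncating to
  finitely many blocks gives \<open>P(F' N \<in> S) \<le> P(F N \<in> S)\<close> for every set \<open>S\<close> (\<open>prob_block_sampling\<close>,
  \<open>prob_painted_alloc_le\<close>). The same inequality for the complement of \<open>S\<close> turns this into equality, and
  consistency extends the equality from single levels to the law of the whole sequence
  (\<open>alloc_law_eqI\<close>).
\<close>

section \<open>Labelling the features of a consistent sequence\<close>


lemma map_eq_mset_eqD:
  assumes "image_mset h X = mset ys"
  obtains xs where "mset xs = X" "map h xs = ys"
  using assms
proof (induction ys arbitrary: X thesis)
  case Nil
  then show ?case by simp
next
  case (Cons y ys)
  then have "image_mset h X = add_mset y (mset ys)" by simp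
  then obtain x X' where X: "X = add_mset x X'" "h x = y" "image_mset h X' = mset ys"
    by (metis msed_map_invR)
  from Cons.IH[OF _ X(3)] obtain xs where "mset xs = X'" "map h xs = ys" by blast
  with X Cons.prems(1)[of "x # xs"] show ?case by simp
qed

text \<open>
  A list of the features of an allocation of \<open>{1..n}\<close>; the label of a feature is its position. The
  list for \<open>n + 1\<close> keeps the features of the restriction to \<open>{1..n}\<close> at their positions, each extended by
  \<open>n + 1\<close> or not, and appends the new features. Since an allocation determines its restrictions, the
  labelling depends on the allocation at level \<open>n\<close> alone, which makes it measurable.
\<close>
primrec labelling :: "nat \<Rightarrow> nat set multiset \<Rightarrow> nat set list" where
  "labelling 0 f = []"
| "labelling (Suc n) f =
     (SOME l. mset l = f \<and> (\<exists>l1 l2. l = l1 @ l2 \<and>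
        map (\<lambda>A. A \<inter> {1..n}) l1 = labelling n (restrict_alloc n f) \<and> (\<forall>A\<in>set l2. A \<inter> {1..n} = {})))"

declare labelling.simps(2)[simp del]

text \<open>
  The labels of the features that contain the index \<open>j\<close>, read off from an allocation of \<open>{1..j}\<close>.
  Labels are shifted by one so that they are positive.
\<close>
definition labels :: "nat \<Rightarrow> nat set multiset \<Rightarrow> nat set" where
  "labels j f = {Suc k | k. k < length (labelling j f) \<and> j \<in> labelling j f ! k}"

text \<open>The allocation of \<open>{1..n}\<close> induced by label sets that are finite on \<open>{1..n}\<close>.\<close>
definition alloc_of :: "(nat \<Rightarrow> nat set) \<Rightarrow> nat \<Rightarrow> nat set multiset" where
  "alloc_of Z n = image_mset (\<lambda>k. {l\<in>{1..n}. k \<in> Z l}) (mset_set (\<Union>l\<in>{1..n}. Z l))"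

text \<open>
  The allocation of \<open>{1..N}\<close> in which \<open>l\<close> has the features that \<open>i l\<close> has in \<open>f\<close>. The map \<open>i\<close> need not be
  injective.
\<close>
definition pullback :: "nat \<Rightarrow> (nat \<Rightarrow> nat) \<Rightarrow> nat set multiset \<Rightarrow> nat set multiset" where
  "pullback N i f = filter_mset (\<lambda>A. A \<noteq> {}) (image_mset (\<lambda>A. {l\<in>{1..N}. i l \<in> A}) f)"

text \<open>The indices \<open>a\<close> and \<open>b\<close> belong to the same features of \<open>f\<close>.\<close>
definition alike :: "nat set multiset \<Rightarrow> nat \<Rightarrow> nat \<Rightarrow> bool" where
  "alike f a b \<longleftrightarrow> (\<forall>A\<in>#f. a \<in> A \<longleftrightarrow> b \<in> A)"

lemma restrict_alloc_mem: "restrict_alloc n f \<in> feature_allocations n"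
  by (auto simp: restrict_alloc_def feature_allocations_def)

lemma feature_allocations_0: "f \<in> feature_allocations 0 \<Longrightarrow> f = {#}"
  by (auto simp: feature_allocations_def)

lemma labelling_properties:
  assumes "f \<in> feature_allocations n"
  shows "mset (labelling n f) = f"
    and "n = Suc m \<Longrightarrow> \<exists>l1 l2. labelling n f = l1 @ l2 \<and>
        map (\<lambda>A. A \<inter> {1..m}) l1 = labelling m (restrict_alloc m f) \<and> (\<forall>A\<in>set l2. A \<inter> {1..m} = {})"
proof -
  have "mset (labelling n f) = f \<and> (\<forall>m. n = Suc m \<longrightarrow> (\<exists>l1 l2. labelling n f = l1 @ l2 \<and>
        map (\<lambda>A. A \<inter> {1..m}) l1 = labelling m (restrict_alloc m f) \<and> (\<forall>A\<in>set l2. A \<inter> {1..m} = {})))"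
    using assms
  proof (induction n arbitrary: f)
    case 0
    then show ?case using feature_allocations_0 by auto
  next
    case (Suc n)
    let ?h = "\<lambda>A::nat set. A \<inter> {1..n}"
    have "mset (labelling n (restrict_alloc n f)) = restrict_alloc n f"
      using Suc.IH restrict_alloc_mem by blast
    also have "\<dots> = image_mset ?h (filter_mset (\<lambda>A. ?h A \<noteq> {}) f)"
      by (simp add: restrict_alloc_def filter_mset_image_mset)
    finally obtain l1 where l1: "mset l1 = filter_mset (\<lambda>A. ?h A \<noteq> {}) f"
      "map ?h l1 = labelling n (restrict_alloc n f)"
      by (rule map_eq_mset_eqD[OF sym])
    obtain l2 where l2: "mset l2 = filter_mset (\<lambda>A. \<not> ?h A \<noteq> {}) f"
      using ex_mset by blast
    have "mset (l1 @ l2) = f" using l1 l2 multiset_partition[of f "\<lambda>A. ?h A \<noteq> {}"] by simp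
    moreover have "\<forall>A\<in>set l2. ?h A = {}"
      using arg_cong[OF l2, of set_mset] by auto
    ultimately have "\<exists>l. mset l = f \<and> (\<exists>l1 l2. l = l1 @ l2 \<and>
        map ?h l1 = labelling n (restrict_alloc n f) \<and> (\<forall>A\<in>set l2. ?h A = {}))"
      using l1 by blast
    from someI_ex[OF this] show ?case unfolding labelling.simps(2) by auto
  qed
  then show "mset (labelling n f) = f" and "n = Suc m \<Longrightarrow> \<exists>l1 l2. labelling n f = l1 @ l2 \<and>
        map (\<lambda>A. A \<inter> {1..m}) l1 = labelling m (restrict_alloc m f) \<and> (\<forall>A\<in>set l2. A \<inter> {1..m} = {})"
    by blast+
qed

lemma labels_subset: "labels j f \<subseteq> {1..length (labelling j f)}"
  by (auto simp: labels_def)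

lemma finite_labels [simp]: "finite (labels j f)"
  using labels_subset finite_subset by blast

locale consistent_sequence =
  fixes f :: "nat \<Rightarrow> nat set multiset"
  assumes alloc: "f n \<in> feature_allocations n"
    and restr: "restrict_alloc n (f (Suc n)) = f n"
begin

abbreviation "L n \<equiv> labelling n (f n)"
abbreviation "Z n \<equiv> labels n (f n)"

lemma Z_0: "Z 0 = {}"
  by (simp add: labels_def)

lemma labelling_Suc:
  obtains l1 l2 where "L (Suc n) = l1 @ l2" "map (\<lambda>A. A \<inter> {1..n}) l1 = L n"
    "\<forall>A\<in>set l2. A \<inter> {1..n} = {}"
  using labelling_properties(2)[OF alloc refl, of n] unfolding restr by blast

text \<open>A label persists through all later levels, so that label sets may be read off at any of them.\<close>
lemma labels_iff:
  assumes "1 \<le> j" "j \<le> n"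
  shows "k < length (L n) \<and> j \<in> L n ! k \<longleftrightarrow> Suc k \<in> Z j"
  using assms(2)
proof (induction n rule: dec_induct)
  case base
  then show ?case by (auto simp: labels_def)
next
  case (step n)
  obtain l1 l2 where l: "L (Suc n) = l1 @ l2" "map (\<lambda>A. A \<inter> {1..n}) l1 = L n"
    "\<forall>A\<in>set l2. A \<inter> {1..n} = {}" by (rule labelling_Suc)
  have len: "length (L n) = length l1" using l(2) by (metis length_map)
  show ?case
  proof (cases "k < length l1")
    case True
    then have "L n ! k = L (Suc n) ! k \<inter> {1..n}" using l by (metis nth_append nth_map)
    then have "j \<in> L n ! k \<longleftrightarrow> j \<in> L (Suc n) ! k" using step assms by auto
    then show ?thesis using step.IH True len l(1) by auto
  next
    case False
    then have n: "Suc k \<notin> Z j" using step.IH len by auto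
    have "j \<notin> L (Suc n) ! k" if "k < length (L (Suc n))"
    proof -
      have "L (Suc n) ! k \<in> set l2" using that False l(1) by (auto simp: nth_append)
      then show ?thesis using l(3) step assms by force
    qed
    then show ?thesis using n by blast
  qed
qed

lemma f_eq_alloc_of: "f n = alloc_of Z n"
proof -
  let ?l = "L n"
  have m: "mset ?l = f n" by (rule labelling_properties(1)[OF alloc])
  have mem: "?l ! k \<noteq> {} \<and> ?l ! k \<subseteq> {1..n}" if "k < length ?l" for k
    using alloc[of n] that m unfolding feature_allocations_def
    by (metis (mono_tags, lifting) mem_Collect_eq nth_mem_mset)
  have set: "(\<Union>j\<in>{1..n}. Z j) = Suc ` {..<length ?l}"
  proof (intro equalityI subsetI)
    fix x assume "x \<in> (\<Union>j\<in>{1..n}. Z j)"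
    then obtain j where j: "j \<in> {1..n}" "x \<in> Z j" by auto
    then obtain k where "x = Suc k" by (auto simp: labels_def)
    then show "x \<in> Suc ` {..<length ?l}" using j labels_iff[of j n k] by auto
  next
    fix x assume "x \<in> Suc ` {..<length ?l}"
    then obtain k where k: "x = Suc k" "k < length ?l" by auto
    then obtain j where "j \<in> ?l ! k" "j \<in> {1..n}" using mem by blast
    then show "x \<in> (\<Union>j\<in>{1..n}. Z j)" using labels_iff[of j n k] k by auto
  qed
  have "{j\<in>{1..n}. Suc k \<in> Z j} = ?l ! k" if "k < length ?l" for k
  proof -
    have "j \<in> ?l ! k \<longleftrightarrow> Suc k \<in> Z j" if "j \<in> {1..n}" for j
      using that \<open>k < length ?l\<close> labels_iff[of j n k] by simp
    then show ?thesis using mem[OF that] by blast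
  qed
  then have "alloc_of Z n = image_mset (\<lambda>k. ?l ! k) (mset_set {..<length ?l})"
    unfolding alloc_of_def set
    by (subst image_mset_mset_set[symmetric])
       (simp, unfold multiset.map_comp o_def, intro image_mset_cong, simp del: atLeastAtMost_iff)
  also have "\<dots> = mset (map (\<lambda>k. ?l ! k) [0..<length ?l])"
    by (simp add: lessThan_atLeast0)
  also have "\<dots> = f n" using m by (simp add: map_nth)
  finally show ?thesis ..
qed

lemma Z_eq_iff:
  assumes "a \<in> {1..n}" "b \<in> {1..n}"
  shows "Z a = Z b \<longleftrightarrow> alike (f n) a b"
proof
  assume "alike (f n) a b"
  then have *: "k \<in> Z a \<longleftrightarrow> k \<in> Z b" if "k \<in> (\<Union>j\<in>{1..n}. Z j)" for k
    using that assms unfolding alike_def f_eq_alloc_of[of n] alloc_of_def by auto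
  show "Z a = Z b" using * assms by blast
next
  assume eq: "Z a = Z b"
  then have "\<forall>A\<in>#alloc_of Z n. a \<in> A \<longleftrightarrow> b \<in> A"
    using assms by (auto simp: alloc_of_def)
  then show "alike (f n) a b" unfolding alike_def f_eq_alloc_of[symmetric] .
qed

lemma alloc_of_reindex:
  assumes "\<And>l. l \<in> {1..N} \<Longrightarrow> i l \<le> n"
  shows "alloc_of (\<lambda>l. Z (i l)) N = pullback N i (f n)"
proof -
  let ?K = "\<Union>j\<in>{1..n}. Z j"
  have mem: "l \<in> {1..N} \<Longrightarrow> k \<in> Z (i l) \<longleftrightarrow> i l \<in> {j\<in>{1..n}. k \<in> Z j}" for l k
    using assms[of l] Z_0 by (cases "i l = 0") auto
  have "pullback N i (f n) = filter_mset (\<lambda>A. A \<noteq> {})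
      (image_mset (\<lambda>k. {l\<in>{1..N}. k \<in> Z (i l)}) (mset_set ?K))"
    unfolding pullback_def f_eq_alloc_of[of n] alloc_of_def multiset.map_comp o_def
    by (intro arg_cong2[of _ _ _ _ filter_mset] refl image_mset_cong)
       (use mem in auto)
  also have "\<dots> = image_mset (\<lambda>k. {l\<in>{1..N}. k \<in> Z (i l)})
      (mset_set {k\<in>?K. {l\<in>{1..N}. k \<in> Z (i l)} \<noteq> {}})"
    by (simp add: filter_mset_image_mset)
  also have "{k\<in>?K. {l\<in>{1..N}. k \<in> Z (i l)} \<noteq> {}} = (\<Union>l\<in>{1..N}. Z (i l))"
    using mem by blast
  finally show ?thesis by (simp add: alloc_of_def)
qed

end

lemma alike_pullback:
  assumes "a \<in> {1..N}" "b \<in> {1..N}"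
  shows "alike (pullback N i f) a b \<longleftrightarrow> alike f (i a) (i b)"
  using assms by (auto simp: alike_def pullback_def)

text \<open>Choosing distinct indices amounts to permuting the allocation and then restricting it.\<close>
lemma pullback_permutation:
  assumes "\<sigma> permutes {1..n}" "\<And>l. l \<in> {1..N} \<Longrightarrow> \<sigma> l = i l"
  shows "pullback N i f = restrict_alloc N (image_mset (\<lambda>A. inv \<sigma> ` A) f)"
proof -
  have "{l\<in>{1..N}. i l \<in> A} = inv \<sigma> ` A \<inter> {1..N}" for A
  proof -
    have "{l\<in>{1..N}. i l \<in> A} = {l\<in>{1..N}. \<sigma> l \<in> A}" using assms(2) by auto
    also have "\<dots> = inv \<sigma> ` A \<inter> {1..N}"
      using assms(1) by (auto simp: permutes_inverses image_iff) (metis permutes_inverses(2))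
    finally show ?thesis .
  qed
  then show ?thesis
    by (simp add: pullback_def restrict_alloc_def multiset.map_comp o_def)
qed

section \<open>Allocations induced by label sets\<close>

lemma alloc_of_cong: "(\<And>l. l \<in> {1..N} \<Longrightarrow> Y l = Y' l) \<Longrightarrow> alloc_of Y N = alloc_of Y' N"
  unfolding alloc_of_def by (intro arg_cong2[of _ _ _ _ image_mset] arg_cong[of _ _ mset_set] ext) auto

lemma alloc_of_mem:
  assumes "\<And>l. l \<in> {1..n} \<Longrightarrow> finite (Z l)"
  shows "alloc_of Z n \<in> feature_allocations n"
  using assms by (auto simp: alloc_of_def feature_allocations_def)

lemma restrict_alloc_of:
  assumes "m \<le> n" "\<And>l. l \<in> {1..n} \<Longrightarrow> finite (Z l)"
  shows "restrict_alloc m (alloc_of Z n) = alloc_of Z m"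
proof -
  have "{l\<in>{1..n}. k \<in> Z l} \<inter> {1..m} = {l\<in>{1..m}. k \<in> Z l}" for k
    using assms(1) by auto
  then have "restrict_alloc m (alloc_of Z n) = filter_mset (\<lambda>A. A \<noteq> {})
      (image_mset (\<lambda>k. {l\<in>{1..m}. k \<in> Z l}) (mset_set (\<Union>l\<in>{1..n}. Z l)))"
    by (simp add: restrict_alloc_def alloc_of_def multiset.map_comp o_def)
  also have "\<dots> = image_mset (\<lambda>k. {l\<in>{1..m}. k \<in> Z l})
      (mset_set {k \<in> (\<Union>l\<in>{1..n}. Z l). {l\<in>{1..m}. k \<in> Z l} \<noteq> {}})"
    using assms(2) by (simp add: filter_mset_image_mset)
  also have "{k \<in> (\<Union>l\<in>{1..n}. Z l). {l\<in>{1..m}. k \<in> Z l} \<noteq> {}} = (\<Union>l\<in>{1..m}. Z l)"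
    using assms(1) by (auto; force)
  finally show ?thesis by (simp add: alloc_of_def)
qed

text \<open>
  The restrictions of the multiset of sets induced by the label sets \<open>Z\<close> are the allocations induced
  by \<open>Z\<close> on \<open>{1..n}\<close>. The proof matches the labels \<open>k\<close> whose set of indices is \<open>A\<close> with the copies of \<open>A\<close>.
\<close>
lemma represents_induced_alloc:
  assumes fin: "\<And>l. 1 \<le> l \<Longrightarrow> finite (Z l)" and pos: "\<And>l. 1 \<le> l \<Longrightarrow> 0 \<notin> Z l"
  shows "represents (induced_alloc Z) (alloc_of Z)"
proof -
  define S where "S k = {n. n \<ge> 1 \<and> k \<in> Z n}" for k
  define c where "c A = {k. k \<ge> 1 \<and> S k = A}" for A
  let ?g = "induced_alloc Z"
  have g: "?g A = (if A = {} then 0 else card (c A))" for A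
    by (simp add: induced_alloc_def c_def S_def)
  have cZ: "c A \<subseteq> Z n" if "n \<in> A" for n A
    using that by (auto simp: c_def S_def)
  have S_ge: "n \<ge> 1" if "n \<in> S k" for n k
    using that by (auto simp: S_def)
  have cfin: "finite (c A)" if ne: "A \<noteq> {}" for A
  proof (cases "c A = {}")
    case False
    then obtain k where k: "k \<in> c A" by auto
    obtain n where "n \<in> A" using ne by auto
    moreover from this have "1 \<le> n" using k S_ge by (auto simp: c_def)
    ultimately show ?thesis using cZ fin finite_subset by blast
  qed auto
  have "\<exists>b. bij_betw b (c A) {..<?g A}" if "A \<noteq> {}" for A
    using ex_bij_betw_finite_nat[OF cfin[OF that]] that by (simp add: g lessThan_atLeast0)
  then obtain \<beta> where \<beta>: "\<And>A. A \<noteq> {} \<Longrightarrow> bij_betw (\<beta> A) (c A) {..<?g A}" by metis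
  define \<phi> where "\<phi> k = (S k, \<beta> (S k) k)" for k
  have bij: "bij_betw \<phi> {k. k \<ge> 1 \<and> S k \<noteq> {}} (features ?g)"
    unfolding bij_betw_def
  proof (intro conjI inj_onI equalityI subsetI)
    fix k k' assume k: "k \<in> {k. k \<ge> 1 \<and> S k \<noteq> {}}" "k' \<in> {k. k \<ge> 1 \<and> S k \<noteq> {}}" "\<phi> k = \<phi> k'"
    then have "\<beta> (S k) k = \<beta> (S k) k'" "k \<in> c (S k)" "k' \<in> c (S k)" "S k \<noteq> {}" by (auto simp: \<phi>_def c_def)
    then show "k = k'" using \<beta>[of "S k"] by (meson bij_betw_def inj_onD)
  next
    fix x assume "x \<in> \<phi> ` {k. k \<ge> 1 \<and> S k \<noteq> {}}"
    then obtain k where k: "k \<ge> 1" "S k \<noteq> {}" "x = \<phi> k" by auto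
    then have "k \<in> c (S k)" by (simp add: c_def)
    then have "\<beta> (S k) k < ?g (S k)" using bij_betw_apply[OF \<beta>[OF k(2)]] by blast
    then show "x \<in> features ?g" unfolding k(3) \<phi>_def features_def by simp
  next
    fix x assume x: "x \<in> features ?g"
    obtain A i where [simp]: "x = (A, i)" by fastforce
    from x have i: "i < ?g A" by (auto simp: features_def)
    then have ne: "A \<noteq> {}" by (auto simp: g split: if_splits)
    obtain k where k: "k \<in> c A" "\<beta> A k = i"
      using bij_betw_imp_surj_on[OF \<beta>[OF ne]] i by (metis imageE lessThan_iff)
    then have "\<phi> k = x" "k \<ge> 1" "S k = A" by (auto simp: \<phi>_def c_def)
    then have "k \<in> {k. k \<ge> 1 \<and> S k \<noteq> {}}" using ne by simp
    then show "x \<in> \<phi> ` {k. k \<ge> 1 \<and> S k \<noteq> {}}" using \<open>\<phi> k = x\<close> by blast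
  qed
  then have feat: "features ?g = \<phi> ` {k. k \<ge> 1 \<and> S k \<noteq> {}}" by (simp add: bij_betw_def)
  have fst_\<phi>: "fst (\<phi> k) = S k" for k by (simp add: \<phi>_def)
  have "inf_feature_allocation ?g"
    unfolding inf_feature_allocation_def
  proof (intro conjI allI impI)
    show "\<forall>(A, i)\<in>features ?g. A \<noteq> {} \<and> A \<subseteq> {1..}"
      unfolding feat by (auto simp: \<phi>_def S_def)
    fix n :: nat assume n: "1 \<le> n"
    have "features_of ?g n \<subseteq> \<phi> ` Z n"
      unfolding features_of_def feat using n by (auto simp: fst_\<phi> S_def)
    then show "finite (features_of ?g n)" using fin[OF n] finite_surj by blast
  qed
  moreover have "alloc_of Z n = inf_restrict_alloc n ?g" if "1 \<le> n" for n
  proof -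
    have cut: "S k \<inter> {1..n} = {l\<in>{1..n}. k \<in> Z l}" for k by (auto simp: S_def)
    have lab: "(\<Union>l\<in>{1..n}. Z l) = {k. k \<ge> 1 \<and> S k \<inter> {1..n} \<noteq> {}}"
    proof (intro equalityI subsetI)
      fix k assume "k \<in> (\<Union>l\<in>{1..n}. Z l)"
      then obtain l where l: "l \<in> {1..n}" "k \<in> Z l" by auto
      then have "l \<in> S k \<inter> {1..n}" by (simp add: S_def)
      moreover have "k \<noteq> 0" using l pos[of l] by (cases "k = 0") auto
      ultimately show "k \<in> {k. k \<ge> 1 \<and> S k \<inter> {1..n} \<noteq> {}}" by auto
    qed (auto simp: S_def)
    have "{x \<in> features ?g. fst x \<inter> {1..n} \<noteq> {}} = \<phi> ` {k. k \<ge> 1 \<and> S k \<inter> {1..n} \<noteq> {}}"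
    proof (intro equalityI subsetI)
      fix x assume "x \<in> {x \<in> features ?g. fst x \<inter> {1..n} \<noteq> {}}"
      then obtain k where k: "k \<ge> 1" "x = \<phi> k" "fst x \<inter> {1..n} \<noteq> {}" unfolding feat by blast
      then have "k \<in> {k. k \<ge> 1 \<and> S k \<inter> {1..n} \<noteq> {}}" using fst_\<phi>[of k] by simp
      then show "x \<in> \<phi> ` {k. k \<ge> 1 \<and> S k \<inter> {1..n} \<noteq> {}}" using k(2) by (rule image_eqI[rotated])
    next
      fix x assume "x \<in> \<phi> ` {k. k \<ge> 1 \<and> S k \<inter> {1..n} \<noteq> {}}"
      then obtain k where k: "k \<ge> 1" "x = \<phi> k" "S k \<inter> {1..n} \<noteq> {}" by blast
      then have "x \<in> features ?g" unfolding feat by blast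
      then show "x \<in> {x \<in> features ?g. fst x \<inter> {1..n} \<noteq> {}}" using k fst_\<phi>[of k] by simp
    qed
    moreover have "inj_on \<phi> {k. k \<ge> 1 \<and> S k \<inter> {1..n} \<noteq> {}}"
      by (rule inj_on_subset[OF bij_betw_imp_inj_on[OF bij]]) auto
    ultimately have "mset_set {x \<in> features ?g. fst x \<inter> {1..n} \<noteq> {}} = image_mset \<phi> (mset_set (\<Union>l\<in>{1..n}. Z l))"
      unfolding lab by (simp only: image_mset_mset_set)
    then show ?thesis
      unfolding inf_restrict_alloc_def alloc_of_def by (simp only: multiset.map_comp o_def fst_\<phi> cut)
  qed
  ultimately show ?thesis by (simp add: represents_def)
qed

lemma alike_if_same_features:
  assumes "represents g f" "features_of g a = features_of g b" "a \<in> {1..n}" "b \<in> {1..n}"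
  shows "alike (f n) a b"
proof -
  have *: "f n = inf_restrict_alloc n g" using assms(1,3) by (auto simp: represents_def)
  show ?thesis
    unfolding alike_def
  proof
    fix A assume A: "A \<in># f n"
    let ?X = "{x \<in> features g. fst x \<inter> {1..n} \<noteq> {}}"
    have "finite ?X"
      using A unfolding * inf_restrict_alloc_def by (cases "finite ?X") auto
    then obtain x where x: "x \<in> features g" "A = fst x \<inter> {1..n}"
      using A unfolding * inf_restrict_alloc_def by auto
    have "x \<in> features_of g a \<longleftrightarrow> x \<in> features_of g b" using assms(2) by simp
    then show "a \<in> A \<longleftrightarrow> b \<in> A" using x assms by (auto simp: features_of_def)
  qed
qed


section \<open>Averages of exchangeable variables\<close>

lemma ex_bound: "\<exists>n. \<forall>l\<in>{1..N::nat}. i l \<le> (n::nat)"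
  by (intro exI[of _ "Max (i ` {1..N})"]) auto

lemma injective_extends_to_permutation:
  assumes inj: "inj_on i A" and sub: "A \<subseteq> B" "i ` A \<subseteq> B" and fin: "finite B"
  obtains \<sigma> where "\<sigma> permutes B" "\<And>l. l \<in> A \<Longrightarrow> \<sigma> l = i l"
proof -
  have finA: "finite A" using sub fin finite_subset by blast
  have "card (B - A) = card (B - i ` A)"
    using sub finA by (simp add: card_Diff_subset card_image[OF inj])
  then obtain g where g: "bij_betw g (B - A) (B - i ` A)"
    using fin finite_same_card_bij by (metis finite_Diff)
  define \<sigma> where "\<sigma> x = (if x \<in> A then i x else if x \<in> B then g x else x)" for x
  have "bij_betw \<sigma> A (i ` A)" using inj by (simp add: bij_betw_def \<sigma>_def cong: inj_on_cong)
  moreover have "bij_betw \<sigma> (B - A) (B - i ` A)"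
    using g by (subst bij_betw_cong[of _ _ g]) (auto simp: \<sigma>_def)
  ultimately have "bij_betw \<sigma> (A \<union> (B - A)) (i ` A \<union> (B - i ` A))"
    by (rule bij_betw_combine) auto
  then have "bij_betw \<sigma> B B" using sub by (simp add: Un_absorb1)
  then have "\<sigma> permutes B"
    by (rule bij_imp_permutes) (use sub in \<open>auto simp: \<sigma>_def\<close>)
  then show ?thesis by (rule that) (simp add: \<sigma>_def)
qed

lemma sum_double_two_values:
  fixes c :: "'a \<Rightarrow> real"
  assumes "finite A"
  shows "(\<Sum>i\<in>A. \<Sum>k\<in>A. c i * c k * (if i = k then \<alpha> else \<beta>)) =
         \<beta> * (\<Sum>i\<in>A. c i)\<^sup>2 + (\<alpha> - \<beta>) * (\<Sum>i\<in>A. (c i)\<^sup>2)"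
proof -
  have "(\<Sum>i\<in>A. \<Sum>k\<in>A. c i * c k * (if i = k then \<alpha> else \<beta>)) =
      (\<Sum>i\<in>A. \<Sum>k\<in>A. \<beta> * (c i * c k) + (if i = k then (\<alpha> - \<beta>) * (c i)\<^sup>2 else 0))"
    by (intro sum.cong refl) (auto simp: algebra_simps power2_eq_square)
  also have "\<dots> = (\<Sum>i\<in>A. \<Sum>k\<in>A. \<beta> * (c i * c k)) + (\<Sum>i\<in>A. (\<alpha> - \<beta>) * (c i)\<^sup>2)"
    using assms by (simp add: sum.distrib)
  also have "(\<Sum>i\<in>A. \<Sum>k\<in>A. \<beta> * (c i * c k)) = \<beta> * (\<Sum>i\<in>A. c i)\<^sup>2"
    unfolding power2_eq_square sum_product by (simp only: sum_distrib_left)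
  finally show ?thesis by (simp add: sum_distrib_left)
qed

context prob_space
begin

lemma expectation_of_bool:
  "expectation (\<lambda>w. of_bool (P w)) = prob {w\<in>space M. P w}"
proof -
  have "expectation (\<lambda>w. of_bool (P w)) = expectation (indicator {w\<in>space M. P w})"
    by (intro Bochner_Integration.integral_cong) (auto simp: indicator_def)
  also have "\<dots> = prob ({w\<in>space M. P w} \<inter> space M)" by simp
  also have "{w\<in>space M. P w} \<inter> space M = {w\<in>space M. P w}" by blast
  finally show ?thesis .
qed

text \<open>
  Along the powers of 4, the averages of bounded variables with exchangeable second moments converge
  almost surely: a combination of the variables whose coefficients sum to 0 has second moment
  proportional to the sum of the squared coefficients, so successive averages differ by
  at most \<open>2^(-k)\<close> in \<open>L^1\<close>, which is summable.
\<close>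
lemma averages_converge:
  fixes X :: "nat \<Rightarrow> 'a \<Rightarrow> real"
  assumes X[measurable]: "\<And>i. X i \<in> borel_measurable M"
    and bound: "\<And>i w. w \<in> space M \<Longrightarrow> 0 \<le> X i w \<and> X i w \<le> 1"
    and same: "\<And>i. expectation (\<lambda>w. X i w * X i w) = \<alpha>"
    and diff: "\<And>i k. i \<noteq> k \<Longrightarrow> expectation (\<lambda>w. X i w * X k w) = \<beta>"
  shows "AE w in M. convergent (\<lambda>k. (\<Sum>i<4^k. X i w) / 4^k)"
proof -
  define A where "A k w = (\<Sum>i<4^k. X i w) / 4^k" for k w
  define D where "D k w = A (Suc k) w - A k w" for k w
  have [measurable]: "D k \<in> borel_measurable M" "A k \<in> borel_measurable M" for k
    unfolding D_def A_def by measurable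
  have int: "integrable M (\<lambda>w. X i w * X k w)" for i k
  proof (rule integrable_const_bound[of _ 1])
    show "AE w in M. norm (X i w * X k w) \<le> 1"
      using bound by (intro AE_I2) (auto simp: abs_mult intro: mult_le_one)
  qed measurable
  have \<alpha>: "\<alpha> \<le> 1" unfolding same[of 0, symmetric]
    using bound by (intro integral_le_const int AE_I2) (auto intro: mult_le_one)
  have \<beta>: "0 \<le> \<beta>" unfolding diff[of 0 1, symmetric, simplified]
    using bound by (intro integral_nonneg_AE AE_I2) auto
  have D2: "expectation (\<lambda>w. (D k w)\<^sup>2) \<le> 1 / 4^k" and D2int: "integrable M (\<lambda>w. (D k w)\<^sup>2)" for k
  proof -
    let ?n = "4^k :: nat" and ?m = "4^Suc k :: nat"
    \<comment> \<open>The coefficients of the difference: \<open>1 / 4^(k+1) - 1 / 4^k\<close> on the old indices, \<open>1 / 4^(k+1)\<close> on the new ones.\<close>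
    define c where "c i = (if i < ?n then - 3 / (4 * 4^k) else 1 / (4 * 4^k) :: real)" for i
    have split: "{..<?m} = {..<?n} \<union> {?n..<?m}" "{..<?n} \<inter> {?n..<?m} = {}" by auto
    have sum_split: "(\<Sum>i<?m. g i) = (\<Sum>i<?n. g i) + (\<Sum>i\<in>{?n..<?m}. g i)" for g :: "nat \<Rightarrow> real"
      unfolding split(1) by (rule sum.union_disjoint) auto
    have c_lo: "(\<Sum>i<?n. g (c i) i) = (\<Sum>i<?n. g (- 3 / (4 * 4^k)) i)" for g :: "real \<Rightarrow> nat \<Rightarrow> real"
      by (intro sum.cong) (auto simp: c_def)
    have c_hi: "(\<Sum>i\<in>{?n..<?m}. g (c i) i) = (\<Sum>i\<in>{?n..<?m}. g (1 / (4 * 4^k)) i)" for g :: "real \<Rightarrow> nat \<Rightarrow> real"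
      by (intro sum.cong) (auto simp: c_def)
    have D: "D k w = (\<Sum>i<?m. c i * X i w)" for w
    proof -
      have "D k w = ((\<Sum>i<?n. X i w) + (\<Sum>i\<in>{?n..<?m}. X i w)) / (4 * 4^k) - (\<Sum>i<?n. X i w) / 4^k"
        unfolding D_def A_def sum_split by simp
      also have "\<dots> = - 3 / (4 * 4^k) * (\<Sum>i<?n. X i w) + 1 / (4 * 4^k) * (\<Sum>i\<in>{?n..<?m}. X i w)"
        by (simp add: field_simps)
      also have "\<dots> = (\<Sum>i<?m. c i * X i w)"
        unfolding sum_split c_lo[of "\<lambda>c i. c * X i w"] c_hi[of "\<lambda>c i. c * X i w"]
        by (simp only: sum_distrib_left)
      finally show ?thesis .
    qed
    have "(D k w)\<^sup>2 = (\<Sum>i<?m. \<Sum>j<?m. c i * c j * (X i w * X j w))" for w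
      unfolding D power2_eq_square sum_product by (intro sum.cong refl) (simp add: algebra_simps)
    note Dsq = this
    show int': "integrable M (\<lambda>w. (D k w)\<^sup>2)"
      unfolding Dsq by (intro Bochner_Integration.integrable_sum integrable_mult_right int)
    have "expectation (\<lambda>w. (D k w)\<^sup>2) = (\<Sum>i<?m. \<Sum>j<?m. c i * c j * expectation (\<lambda>w. X i w * X j w))"
      unfolding Dsq using int by (simp add: Bochner_Integration.integral_sum)
    also have "\<dots> = (\<Sum>i<?m. \<Sum>j<?m. c i * c j * (if i = j then \<alpha> else \<beta>))"
      by (intro sum.cong refl) (auto simp: same diff)
    also have "\<dots> = \<beta> * (\<Sum>i<?m. c i)\<^sup>2 + (\<alpha> - \<beta>) * (\<Sum>i<?m. (c i)\<^sup>2)"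
      by (rule sum_double_two_values) simp
    also have "(\<Sum>i<?m. c i) = 0"
      unfolding sum_split c_lo[of "\<lambda>c i. c"] c_hi[of "\<lambda>c i. c"] by (simp add: field_simps)
    also have "(\<Sum>i<?m. (c i)\<^sup>2) = 3 / (4 * 4^k)"
      unfolding sum_split c_lo[of "\<lambda>c i. c\<^sup>2"] c_hi[of "\<lambda>c i. c\<^sup>2"]
      by (simp add: field_simps power2_eq_square)
    also have "\<beta> * 0\<^sup>2 + (\<alpha> - \<beta>) * (3 / (4 * 4^k)) \<le> 1 * (1 / 4^k :: real)"
    proof -
      have "(\<alpha> - \<beta>) * (3 / (4 * 4^k)) \<le> 1 * (3 / (4 * 4^k) :: real)"
        using \<alpha> \<beta> by (intro mult_right_mono) auto
      also have "\<dots> \<le> 1 / 4^k" by (simp add: field_simps)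
      finally show ?thesis by simp
    qed
    finally show "expectation (\<lambda>w. (D k w)\<^sup>2) \<le> 1 / 4^k" by simp
  qed
  have D1: "(\<integral>\<^sup>+w. ennreal \<bar>D k w\<bar> \<partial>M) \<le> ennreal ((1/2)^k)" for k
  proof -
    have "(\<integral>\<^sup>+w. ennreal \<bar>D k w\<bar> \<partial>M) \<le> (\<integral>\<^sup>+w. ennreal ((2^k * (D k w)\<^sup>2 + (1/2)^k) / 2) \<partial>M)"
    proof (intro nn_integral_mono ennreal_leI)
      fix w
      \<comment> \<open>Arithmetic-geometric mean, weighted so that both terms have expectation of order \<open>2^(-k)\<close>.\<close>
      have "0 \<le> (2^k * \<bar>D k w\<bar> - 1)\<^sup>2 / 2^k" by simp
      also have "\<dots> = 2^k * (D k w)\<^sup>2 + (1/2)^k - 2 * \<bar>D k w\<bar>"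
        by (simp add: power2_eq_square field_simps)
      finally show "\<bar>D k w\<bar> \<le> (2^k * (D k w)\<^sup>2 + (1/2)^k) / 2" by simp
    qed
    also have "\<dots> = ennreal (expectation (\<lambda>w. (2^k * (D k w)\<^sup>2 + (1/2)^k) / 2))"
      using D2int by (intro nn_integral_eq_integral AE_I2) auto
    also have "expectation (\<lambda>w. (2^k * (D k w)\<^sup>2 + (1/2)^k) / 2) = (2^k * expectation (\<lambda>w. (D k w)\<^sup>2) + (1/2)^k) / 2"
      using D2int by (simp add: prob_space)
    also have "\<dots> \<le> (2^k * (1/4^k) + (1/2)^k) / 2"
      using D2[of k] by (intro divide_right_mono add_right_mono mult_left_mono) auto
    also have "\<dots> = (1/2)^k"
    proof -
      have "(4::real)^k = 2^k * 2^k" by (simp flip: power_mult_distrib)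
      then show ?thesis by (simp add: field_simps)
    qed
    finally show ?thesis by (simp add: ennreal_leI)
  qed
  have "(\<integral>\<^sup>+w. (\<Sum>k. ennreal \<bar>D k w\<bar>) \<partial>M) = (\<Sum>k. \<integral>\<^sup>+w. ennreal \<bar>D k w\<bar> \<partial>M)"
    by (rule nn_integral_suminf) measurable
  also have "\<dots> \<le> (\<Sum>k. ennreal ((1/2)^k))"
    using D1 by (intro suminf_le) auto
  also have "\<dots> = ennreal (\<Sum>k. (1/2)^k)"
    by (intro suminf_ennreal2) (auto intro: summable_geometric)
  finally have "(\<integral>\<^sup>+w. (\<Sum>k. ennreal \<bar>D k w\<bar>) \<partial>M) \<noteq> \<infinity>"
    using ennreal_less_top leD top.not_eq_extremum by (metis infinity_ennreal_def)
  then have "AE w in M. (\<Sum>k. ennreal \<bar>D k w\<bar>) \<noteq> \<infinity>"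
    by (intro nn_integral_noteq_infinite) measurable
  then show ?thesis
  proof eventually_elim
    case (elim w)
    then have "summable (\<lambda>k. \<bar>D k w\<bar>)" by (intro summable_suminf_not_top) auto
    then have "summable (\<lambda>k. D k w)" by (rule summable_rabs_cancel)
    then have "convergent (\<lambda>n. \<Sum>k<n. D k w)" by (simp add: summable_iff_convergent)
    moreover have "(\<Sum>k<n. D k w) = A n w - A 0 w" for n
      unfolding D_def by (rule sum_lessThan_telescope)
    ultimately have "convergent (\<lambda>n. (A n w - A 0 w) + A 0 w)"
      by (intro convergent_add convergent_const) simp
    then show ?case by (simp add: A_def)
  qed
qed

end

section \<open>Exchangeable consistent sequences\<close>

text \<open>
  A random sequence of allocations that is consistent everywhere rather than almost surely, and whose
  first index almost surely shares all its features with some later index. The latter is all that is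
  needed of regularity. Note that index 1 and index \<open>m\<close> share their features if and only if they do so
  at level \<open>m\<close>.
\<close>
locale exchangeable_allocation = prob_space M
  for M :: "'w measure" +
  fixes f :: "nat \<Rightarrow> 'w \<Rightarrow> nat set multiset"
  assumes alloc: "w \<in> space M \<Longrightarrow> f n w \<in> feature_allocations n"
    and restr: "w \<in> space M \<Longrightarrow> restrict_alloc n (f (Suc n) w) = f n w"
    and meas: "f n \<in> measurable M (count_space UNIV)"
    and exch: "\<sigma> permutes {1..n} \<Longrightarrow>
      prob {w\<in>space M. image_mset ((`) \<sigma>) (f n w) \<in> S} = prob {w\<in>space M. f n w \<in> S}"
    and twin: "AE w in M. \<exists>m\<ge>2. alike (f m w) 1 m"
begin

abbreviation Z :: "nat \<Rightarrow> 'w \<Rightarrow> nat set" where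
  "Z n w \<equiv> labels n (f n w)"

lemma consistent: "w \<in> space M \<Longrightarrow> consistent_sequence (\<lambda>n. f n w)"
  by unfold_locales (use alloc restr in auto)

text \<open>
  Everything that concerns finitely many label sets is a function of the allocation at one level,
  hence measurable.
\<close>
lemma measurable_via_f:
  assumes "\<And>w. w \<in> space M \<Longrightarrow> P w = Q (f n w)"
  shows "Measurable.pred M P"
proof -
  have "Measurable.pred M (\<lambda>w. Q (f n w))"
    by (rule measurable_compose[OF meas]) simp
  then show ?thesis by (subst measurable_cong[OF assms])
qed

lemma restrict_f: "w \<in> space M \<Longrightarrow> m \<le> n \<Longrightarrow> restrict_alloc m (f n w) = f m w"
  using consistent_sequence.f_eq_alloc_of[OF consistent, of w n]
    consistent_sequence.f_eq_alloc_of[OF consistent, of w m] restrict_alloc_of[of m n "\<lambda>n. Z n w"]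
  by simp

lemma pred_Z_f: "Measurable.pred M (\<lambda>w. R (Z a w))"
  by (rule measurable_via_f[of _ "\<lambda>x. R (labels a x)" a]) simp

lemma pred_Z_eq [measurable]: "Measurable.pred M (\<lambda>w. Z a w = Z b w)"
proof (rule measurable_via_f[of _
      "\<lambda>x. labels a (restrict_alloc a x) = labels b (restrict_alloc b x)" "max a b"])
  fix w assume "w \<in> space M"
  then show "(Z a w = Z b w) = (labels a (restrict_alloc a (f (max a b) w)) = labels b (restrict_alloc b (f (max a b) w)))"
    by (simp add: restrict_f)
qed

lemma reindex_eq_pullback:
  assumes "w \<in> space M" "\<And>l. l \<in> {1..N} \<Longrightarrow> i l \<le> n"
  shows "alloc_of (\<lambda>l. Z (i l) w) N = pullback N i (f n w)"
  using consistent_sequence.alloc_of_reindex[OF consistent[OF assms(1)] assms(2)] by simp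

lemma pred_reindex [measurable]: "Measurable.pred M (\<lambda>w. Q (alloc_of (\<lambda>l. Z (i l) w) N))"
proof -
  obtain n where "\<forall>l\<in>{1..N}. i l \<le> n" using ex_bound by blast
  then show ?thesis
    by (intro measurable_via_f[of _ "\<lambda>x. Q (pullback N i x)" n]) (subst reindex_eq_pullback; auto)
qed

text \<open>Exchangeability, for an arbitrary choice of distinct indices.\<close>
lemma prob_reindex:
  assumes inj: "inj_on i {1..N}" and pos: "\<And>l. l \<in> {1..N} \<Longrightarrow> 1 \<le> i l"
  shows "prob {w\<in>space M. Q (alloc_of (\<lambda>l. Z (i l) w) N)} = prob {w\<in>space M. Q (f N w)}"
proof -
  obtain n0 where n0: "\<forall>l\<in>{1..N}. i l \<le> n0" using ex_bound by blast
  define n where "n = max n0 N"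
  have n: "\<And>l. l \<in> {1..N} \<Longrightarrow> i l \<le> n" "N \<le> n" using n0 by (auto simp: n_def le_max_iff_disj)
  obtain \<sigma> where \<sigma>: "\<sigma> permutes {1..n}" "\<And>l. l \<in> {1..N} \<Longrightarrow> \<sigma> l = i l"
    by (rule injective_extends_to_permutation[OF inj, of "{1..n}"]) (use n pos in auto)
  have "{w\<in>space M. Q (alloc_of (\<lambda>l. Z (i l) w) N)} =
      {w\<in>space M. image_mset ((`) (inv \<sigma>)) (f n w) \<in> {x. Q (restrict_alloc N x)}}"
    using reindex_eq_pullback[of _ N i n] n(1) pullback_permutation[OF \<sigma>] by auto
  also have "prob \<dots> = prob {w\<in>space M. f n w \<in> {x. Q (restrict_alloc N x)}}"
    by (rule exch[OF permutes_inv[OF \<sigma>(1)]])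
  also have "{w\<in>space M. f n w \<in> {x. Q (restrict_alloc N x)}} = {w\<in>space M. Q (f N w)}"
    using restrict_f[OF _ n(2)] by auto
  finally show ?thesis .
qed

lemma Z_eq_iff_alike:
  assumes "w \<in> space M" "a \<in> {1..N}" "b \<in> {1..N}" "\<And>l. l \<in> {1..N} \<Longrightarrow> 1 \<le> i l"
  shows "Z (i a) w = Z (i b) w \<longleftrightarrow> alike (alloc_of (\<lambda>l. Z (i l) w) N) a b"
proof -
  obtain n where n: "\<forall>l\<in>{1..N}. i l \<le> n" using ex_bound by blast
  then have "Z (i a) w = Z (i b) w \<longleftrightarrow> alike (f n w) (i a) (i b)"
    using assms by (intro consistent_sequence.Z_eq_iff[OF consistent]) auto
  then show ?thesis
    using reindex_eq_pullback[OF assms(1), of N i n] n alike_pullback[OF assms(2,3)] by auto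
qed


section \<open>Block frequencies\<close>

text \<open>
  Two indices are in the same block if they have the same label set. The function \<open>freq n j\<close> is the
  proportion of the indices in \<open>{1..n}\<close> that belong to the block of \<open>j\<close>.
\<close>
definition freq :: "nat \<Rightarrow> nat \<Rightarrow> 'w \<Rightarrow> real" where
  "freq n j w = (\<Sum>i\<in>{1..n}. of_bool (Z i w = Z j w)) / n"

text \<open>Blocks are represented by their least index.\<close>
definition first_in_block :: "nat \<Rightarrow> 'w \<Rightarrow> bool" where
  "first_in_block j w \<longleftrightarrow> 1 \<le> j \<and> (\<forall>i\<in>{1..<j}. Z i w \<noteq> Z j w)"

text \<open>The proportion of a block in \<open>{1..4^k}\<close> counted at its least index, and 0 at its other indices.\<close>
definition block_freq :: "nat \<Rightarrow> nat \<Rightarrow> 'w \<Rightarrow> real" where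
  "block_freq k j w = of_bool (first_in_block j w) * freq (4^k) j w"

text \<open>
  The limit of \<open>block_freq k j\<close> (almost surely it exists). The maximum with 0 keeps the value
  nonnegative where the limit does not exist.
\<close>
definition mass :: "nat \<Rightarrow> 'w \<Rightarrow> real" where
  "mass j w = of_bool (first_in_block j w) * max 0 (lim (\<lambda>k. freq (4^k) j w))"

lemma freq_measurable [measurable]: "freq n j \<in> borel_measurable M"
  unfolding freq_def by measurable

lemma first_in_block_measurable [measurable]: "Measurable.pred M (first_in_block j)"
  unfolding first_in_block_def by measurable

lemma block_freq_measurable [measurable]: "block_freq k j \<in> borel_measurable M"
  unfolding block_freq_def by measurable

lemma mass_measurable [measurable]: "mass j \<in> borel_measurable M"
  unfolding mass_def by measurable

lemma mass_nonneg: "0 \<le> mass j w"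
  by (simp add: mass_def)

lemma freq_bounds: "0 \<le> freq n j w" "freq n j w \<le> 1"
proof -
  show "0 \<le> freq n j w" by (simp add: freq_def sum_nonneg)
  have "(\<Sum>i\<in>{1..n}. of_bool (Z i w = Z j w)) \<le> (\<Sum>i\<in>{1..n}. 1::real)"
    by (intro sum_mono) auto
  then show "freq n j w \<le> 1" by (cases "n = 0") (auto simp: freq_def)
qed

lemma block_freq_bounds: "0 \<le> block_freq k j w" "block_freq k j w \<le> 1"
  using freq_bounds by (auto simp: block_freq_def)

lemma prob_pair_eq:
  assumes "i \<noteq> j" "1 \<le> i" "1 \<le> j"
  shows "prob {w\<in>space M. Z i w = Z j w} = prob {w\<in>space M. alike (f 2 w) 1 2}"
proof -
  let ?i = "\<lambda>l::nat. if l = 1 then i else j"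
  have *: "{1..2::nat} = {1, 2}" by auto
  have "Z (?i 1) w = Z (?i 2) w \<longleftrightarrow> alike (alloc_of (\<lambda>l. Z (?i l) w) 2) 1 2" if "w \<in> space M" for w
    by (rule Z_eq_iff_alike[OF that]) (use assms in auto)
  then have "{w\<in>space M. Z i w = Z j w} = {w\<in>space M. alike (alloc_of (\<lambda>l. Z (?i l) w) 2) 1 2}"
    by (intro Collect_cong conj_cong refl) simp
  also have "prob \<dots> = prob {w\<in>space M. alike (f 2 w) 1 2}"
  proof (rule prob_reindex[where i = ?i])
    show "inj_on ?i {1..2}" unfolding * using assms by (simp add: inj_on_def)
  qed (use assms in simp)
  finally show ?thesis .
qed

lemma prob_triple_eq:
  assumes "i \<noteq> j" "i' \<noteq> j" "i \<noteq> i'" "1 \<le> i" "1 \<le> i'" "1 \<le> j"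
  shows "prob {w\<in>space M. Z i w = Z j w \<and> Z i' w = Z j w} =
    prob {w\<in>space M. alike (f 3 w) 1 3 \<and> alike (f 3 w) 2 3}"
proof -
  let ?i = "\<lambda>l::nat. if l = 1 then i else if l = 2 then i' else j"
  have "Z (?i 1) w = Z (?i 3) w \<longleftrightarrow> alike (alloc_of (\<lambda>l. Z (?i l) w) 3) 1 3"
    "Z (?i 2) w = Z (?i 3) w \<longleftrightarrow> alike (alloc_of (\<lambda>l. Z (?i l) w) 3) 2 3" if "w \<in> space M" for w
    by (rule Z_eq_iff_alike[OF that]; use assms in auto)+
  then have eq: "{w\<in>space M. Z i w = Z j w \<and> Z i' w = Z j w} =
    {w\<in>space M. alike (alloc_of (\<lambda>l. Z (?i l) w) 3) 1 3 \<and> alike (alloc_of (\<lambda>l. Z (?i l) w) 3) 2 3}"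
    by (intro Collect_cong conj_cong refl) simp_all
  have inj: "inj_on ?i {1..3}"
  proof (rule inj_onI)
    fix x y assume "x \<in> {1..3::nat}" "y \<in> {1..3::nat}" "?i x = ?i y"
    moreover from this have "x = 1 \<or> x = 2 \<or> x = 3" "y = 1 \<or> y = 2 \<or> y = 3" by auto
    ultimately show "x = y" using assms(1-3) by (elim disjE) simp_all
  qed
  have pos: "1 \<le> ?i l" for l using assms(4-6) by simp
  show ?thesis
    unfolding eq by (rule prob_reindex[OF inj pos, of "\<lambda>x. alike x 1 3 \<and> alike x 2 3"])
qed

text \<open>
  The indicators of \<open>Z i = Z j\<close> are exchangeable only over \<open>i \<noteq> j\<close>. The averages over \<open>{j+1..j+4^k}\<close>
  therefore converge, and they differ from \<open>freq (4^k) j\<close> by at most \<open>j / 4^k\<close>.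
\<close>
lemma freq_converges:
  assumes j: "1 \<le> j"
  shows "AE w in M. convergent (\<lambda>k. freq (4^k) j w)"
proof -
  define X where "X i w = (of_bool (Z (j + 1 + i) w = Z j w) :: real)" for i w
  have "AE w in M. convergent (\<lambda>k. (\<Sum>i<4^k. X i w) / 4^k)"
  proof (rule averages_converge)
    show "X i \<in> borel_measurable M" for i unfolding X_def by measurable
    show "0 \<le> X i w \<and> X i w \<le> 1" for i w by (simp add: X_def)
    show "expectation (\<lambda>w. X i w * X i w) = prob {w\<in>space M. alike (f 2 w) 1 2}" for i
    proof -
      have "expectation (\<lambda>w. X i w * X i w) = expectation (\<lambda>w. of_bool (Z (j + 1 + i) w = Z j w))"
        by (simp add: X_def flip: of_bool_conj)
      also have "\<dots> = prob {w\<in>space M. Z (j + 1 + i) w = Z j w}"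
        by (rule expectation_of_bool)
      also have "\<dots> = prob {w\<in>space M. alike (f 2 w) 1 2}"
        by (rule prob_pair_eq) (use j in auto)
      finally show ?thesis .
    qed
    show "expectation (\<lambda>w. X i w * X k w) = prob {w\<in>space M. alike (f 3 w) 1 3 \<and> alike (f 3 w) 2 3}"
      if "i \<noteq> k" for i k
    proof -
      have "expectation (\<lambda>w. X i w * X k w) =
          expectation (\<lambda>w. of_bool (Z (j + 1 + i) w = Z j w \<and> Z (j + 1 + k) w = Z j w))"
        by (simp add: X_def of_bool_conj)
      also have "\<dots> = prob {w\<in>space M. Z (j + 1 + i) w = Z j w \<and> Z (j + 1 + k) w = Z j w}"
        by (rule expectation_of_bool)
      also have "\<dots> = prob {w\<in>space M. alike (f 3 w) 1 3 \<and> alike (f 3 w) 2 3}"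
        by (rule prob_triple_eq) (use j that in auto)
      finally show ?thesis .
    qed
  qed
  then show ?thesis
  proof eventually_elim
    case (elim w)
    let ?b = "\<lambda>i. of_bool (Z i w = Z j w) :: real"
    have le: "\<bar>freq (4^k) j w - (\<Sum>i<4^k. X i w) / 4^k\<bar> \<le> j / 4^k" for k
    proof -
      let ?n = "4^k :: nat"
      have X: "(\<Sum>i<?n. X i w) = (\<Sum>i\<in>{j+1..j+?n}. ?b i)"
        unfolding X_def
        by (rule sum.reindex_bij_witness[of _ "\<lambda>i. i - (j+1)" "\<lambda>i. j+1+i"]) auto
      have low: "(\<Sum>i\<in>{1..j+?n}. ?b i) = (\<Sum>i\<in>{1..j}. ?b i) + (\<Sum>i\<in>{j+1..j+?n}. ?b i)"
        by (rule sum.ub_add_nat) simp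
      have high: "(\<Sum>i\<in>{1..j+?n}. ?b i) = (\<Sum>i\<in>{1..?n}. ?b i) + (\<Sum>i\<in>{?n+1..j+?n}. ?b i)"
        using sum.ub_add_nat[of 1 ?n ?b j] by (simp only: add.commute[of j ?n])
      have b1: "0 \<le> (\<Sum>i\<in>{1..j}. ?b i)" "(\<Sum>i\<in>{1..j}. ?b i) \<le> j"
        using sum_mono[of "{1..j}" ?b "\<lambda>_. 1"] by (auto intro: sum_nonneg)
      have b2: "0 \<le> (\<Sum>i\<in>{?n+1..j+?n}. ?b i)" "(\<Sum>i\<in>{?n+1..j+?n}. ?b i) \<le> j"
        using sum_mono[of "{?n+1..j+?n}" ?b "\<lambda>_. 1"] by (auto intro: sum_nonneg)
      have "\<bar>(\<Sum>i\<in>{1..?n}. ?b i) - (\<Sum>i<?n. X i w)\<bar> \<le> j"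
        using X low high b1 b2 by linarith
      moreover have "freq ?n j w - (\<Sum>i<?n. X i w) / ?n = ((\<Sum>i\<in>{1..?n}. ?b i) - (\<Sum>i<?n. X i w)) / 4^k"
        by (simp add: freq_def diff_divide_distrib)
      ultimately show ?thesis by (simp add: abs_divide divide_right_mono)
    qed
    have lim: "(\<lambda>k. j / 4^k :: real) \<longlonglongrightarrow> 0"
      by (rule LIMSEQ_divide_realpow_zero) simp
    have "(\<lambda>k. freq (4^k) j w - (\<Sum>i<4^k. X i w) / 4^k) \<longlonglongrightarrow> 0"
      by (rule Lim_null_comparison[OF _ lim]) (use le in simp)
    then have "convergent (\<lambda>k. freq (4^k) j w - (\<Sum>i<4^k. X i w) / 4^k)"
      by (rule convergentI)
    from convergent_add[OF this elim] show ?case by simp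
  qed
qed

lemma block_freq_tendsto: "AE w in M. \<forall>j\<ge>1. (\<lambda>k. block_freq k j w) \<longlonglongrightarrow> mass j w"
proof -
  have "AE w in M. \<forall>j. 1 \<le> j \<longrightarrow> convergent (\<lambda>k. freq (4^k) j w)"
    unfolding AE_all_countable using freq_converges by auto
  then show ?thesis
  proof eventually_elim
    case (elim w)
    show ?case
    proof (intro allI impI)
      fix j :: nat assume "1 \<le> j"
      then have lim: "(\<lambda>k. freq (4^k) j w) \<longlonglongrightarrow> lim (\<lambda>k. freq (4^k) j w)"
        using elim convergent_LIMSEQ_iff by blast
      then have "0 \<le> lim (\<lambda>k. freq (4^k) j w)"
        by (rule LIMSEQ_le_const) (use freq_bounds in auto)
      then have "mass j w = of_bool (first_in_block j w) * lim (\<lambda>k. freq (4^k) j w)"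
        by (simp add: mass_def)
      then show "(\<lambda>k. block_freq k j w) \<longlonglongrightarrow> mass j w"
        unfolding block_freq_def using tendsto_mult_left[OF lim] by simp
    qed
  qed
qed

lemma sum_first_in_block:
  "(\<Sum>j\<in>{1..r}. of_bool (first_in_block j w) * of_bool (Z i w = Z j w)) = (of_bool (\<exists>j\<in>{1..r}. Z i w = Z j w) :: real)"
proof (cases "\<exists>j\<in>{1..r}. Z i w = Z j w")
  case True
  define m where "m = (LEAST j. 1 \<le> j \<and> Z i w = Z j w)"
  obtain j0 where j0: "1 \<le> j0" "j0 \<le> r" "Z i w = Z j0 w" using True by auto
  have m: "1 \<le> m \<and> Z i w = Z m w" unfolding m_def by (rule LeastI[of _ j0]) (use j0 in auto)
  have least: "m \<le> j" if "1 \<le> j" "Z i w = Z j w" for j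
    unfolding m_def using that by (intro Least_le) auto
  have "first_in_block j w \<and> Z i w = Z j w \<longleftrightarrow> j = m" for j
  proof
    assume "first_in_block j w \<and> Z i w = Z j w"
    then show "j = m" using m least[of j] unfolding first_in_block_def
      by (metis atLeastLessThan_iff le_neq_implies_less)
  next
    assume "j = m"
    then show "first_in_block j w \<and> Z i w = Z j w"
      using m least unfolding first_in_block_def by (metis atLeastLessThan_iff leD)
  qed
  then have "(\<Sum>j\<in>{1..r}. of_bool (first_in_block j w) * of_bool (Z i w = Z j w)) =
      (\<Sum>j\<in>{1..r}. if j = m then 1 else 0 :: real)"
    by (intro sum.cong) (auto simp flip: of_bool_conj)
  also have "\<dots> = 1" using m least[of j0] j0 by simp
  finally show ?thesis using True by simp
next
  case False
  then show ?thesis by (auto intro!: sum.neutral)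
qed

lemma sum_block_freq:
  "(\<Sum>j\<in>{1..r}. block_freq k j w) = (\<Sum>i\<in>{1..4^k}. of_bool (\<exists>j\<in>{1..r}. Z i w = Z j w)) / 4^k"
proof -
  have "(\<Sum>j\<in>{1..r}. block_freq k j w) =
      (\<Sum>j\<in>{1..r}. \<Sum>i\<in>{1..4^k}. of_bool (first_in_block j w) * of_bool (Z i w = Z j w)) / 4^k"
    by (simp only: block_freq_def freq_def times_divide_eq_right sum_distrib_left sum_divide_distrib
        of_nat_power of_nat_numeral)
  also have "\<dots> = (\<Sum>i\<in>{1..4^k}. \<Sum>j\<in>{1..r}. of_bool (first_in_block j w) * of_bool (Z i w = Z j w)) / 4^k"
    by (subst sum.swap) simp
  finally show ?thesis unfolding sum_first_in_block .
qed

lemma sum_block_freq_le_1: "(\<Sum>j\<in>{1..r}. block_freq k j w) \<le> 1"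
proof -
  have "(\<Sum>i\<in>{1..4^k::nat}. of_bool (\<exists>j\<in>{1..r}. Z i w = Z j w)) \<le> (\<Sum>i\<in>{1..4^k::nat}. 1::real)"
    by (intro sum_mono) auto
  then show ?thesis unfolding sum_block_freq by (simp add: divide_le_eq_1)
qed

lemma AE_sum_mass_le_1: "AE w in M. \<forall>r. (\<Sum>j\<in>{1..r}. mass j w) \<le> 1"
  using block_freq_tendsto
proof eventually_elim
  case (elim w)
  show ?case
  proof
    fix r
    have "(\<lambda>k. \<Sum>j\<in>{1..r}. block_freq k j w) \<longlonglongrightarrow> (\<Sum>j\<in>{1..r}. mass j w)"
      using elim by (intro tendsto_sum) auto
    then show "(\<Sum>j\<in>{1..r}. mass j w) \<le> 1"
      by (rule LIMSEQ_le_const2) (use sum_block_freq_le_1 in blast)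
  qed
qed

text \<open>
  The probability that a new index falls into the block of one of the first \<open>r\<close> indices. By
  exchangeability it does not matter which index beyond \<open>r\<close> is taken.
\<close>
definition hit :: "nat \<Rightarrow> real" where
  "hit r = prob {w\<in>space M. \<exists>j\<in>{1..r}. alike (f (Suc r) w) (Suc r) j}"

lemma prob_hit:
  assumes "r < i"
  shows "prob {w\<in>space M. \<exists>j\<in>{1..r}. Z i w = Z j w} = hit r"
proof -
  let ?i = "\<lambda>l::nat. if l = Suc r then i else l"
  have "(\<exists>j\<in>{1..r}. Z i w = Z j w) \<longleftrightarrow> (\<exists>j\<in>{1..r}. alike (alloc_of (\<lambda>l. Z (?i l) w) (Suc r)) (Suc r) j)"
    if "w \<in> space M" for w
  proof (rule bex_cong)
    fix j assume j: "j \<in> {1..r}"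
    have "Z (?i (Suc r)) w = Z (?i j) w \<longleftrightarrow> alike (alloc_of (\<lambda>l. Z (?i l) w) (Suc r)) (Suc r) j"
      by (rule Z_eq_iff_alike[OF that]) (use j assms in auto)
    then show "Z i w = Z j w \<longleftrightarrow> alike (alloc_of (\<lambda>l. Z (?i l) w) (Suc r)) (Suc r) j"
      using j by simp
  qed simp
  then have "{w\<in>space M. \<exists>j\<in>{1..r}. Z i w = Z j w} =
     {w\<in>space M. \<exists>j\<in>{1..r}. alike (alloc_of (\<lambda>l. Z (?i l) w) (Suc r)) (Suc r) j}" by blast
  also have "prob \<dots> = hit r"
    unfolding hit_def
    by (rule prob_reindex[where Q = "\<lambda>x. \<exists>j\<in>{1..r}. alike x (Suc r) j"])
       (use assms in \<open>auto simp: inj_on_def\<close>)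
  finally show ?thesis .
qed

text \<open>Reversing the order of the first \<open>r + 1\<close> indices turns the last index into the first.\<close>
lemma hit_eq_prob_return: "hit r = prob {w\<in>space M. \<exists>j\<in>{2..Suc r}. Z 1 w = Z j w}"
proof -
  let ?i = "\<lambda>l::nat. Suc (Suc r) - l"
  have "(\<exists>j\<in>{2..Suc r}. Z 1 w = Z j w) \<longleftrightarrow> (\<exists>j\<in>{1..r}. alike (alloc_of (\<lambda>l. Z (?i l) w) (Suc r)) (Suc r) j)"
    if "w \<in> space M" for w
  proof -
    have *: "Z 1 w = Z (?i j) w \<longleftrightarrow> alike (alloc_of (\<lambda>l. Z (?i l) w) (Suc r)) (Suc r) j" if "j \<in> {1..r}" for j
    proof -
      have "Z (?i (Suc r)) w = Z (?i j) w \<longleftrightarrow> alike (alloc_of (\<lambda>l. Z (?i l) w) (Suc r)) (Suc r) j"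
        by (rule Z_eq_iff_alike[OF \<open>w \<in> space M\<close>]) (use that in auto)
      then show ?thesis by simp
    qed
    have img: "{2..Suc r} = ?i ` {1..r}"
    proof (intro equalityI subsetI)
      fix x assume "x \<in> {2..Suc r}"
      then have "x = ?i (?i x)" "?i x \<in> {1..r}" by auto
      then show "x \<in> ?i ` {1..r}" by blast
    qed auto
    have "(\<exists>j\<in>{2..Suc r}. Z 1 w = Z j w) \<longleftrightarrow> (\<exists>j\<in>{1..r}. Z 1 w = Z (?i j) w)"
      unfolding img by blast
    then show ?thesis using * by blast
  qed
  then have "{w\<in>space M. \<exists>j\<in>{2..Suc r}. Z 1 w = Z j w} =
     {w\<in>space M. \<exists>j\<in>{1..r}. alike (alloc_of (\<lambda>l. Z (?i l) w) (Suc r)) (Suc r) j}" by blast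
  also have "prob \<dots> = hit r"
    unfolding hit_def
    by (rule prob_reindex[where Q = "\<lambda>x. \<exists>j\<in>{1..r}. alike x (Suc r) j"])
       (auto simp: inj_on_def)
  finally show ?thesis ..
qed

lemma hit_tendsto: "hit \<longlonglongrightarrow> 1"
proof -
  define E where "E r = {w\<in>space M. \<exists>j\<in>{2..Suc r}. Z 1 w = Z j w}" for r
  have "(\<lambda>r. prob (E r)) \<longlonglongrightarrow> prob (\<Union>r. E r)"
  proof (rule finite_Lim_measure_incseq)
    show "range E \<subseteq> events" unfolding E_def by auto
    show "incseq E" unfolding E_def incseq_def by fastforce
  qed
  also have "prob (\<Union>r. E r) = 1"
  proof (rule prob_eq_1[THEN iffD2])
    show "(\<Union>r. E r) \<in> events" unfolding E_def by auto
    show "AE w in M. w \<in> (\<Union>r. E r)"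
      using twin AE_space
    proof eventually_elim
      case (elim w)
      then obtain m where m: "m \<ge> 2" "alike (f m w) 1 m" by blast
      then have "Z 1 w = Z m w"
        using consistent_sequence.Z_eq_iff[OF consistent[OF \<open>w \<in> space M\<close>], of 1 m m] by simp
      then have "w \<in> E m" using m elim by (auto simp: E_def)
      then show ?case by blast
    qed
  qed
  finally show ?thesis by (simp add: E_def hit_eq_prob_return[abs_def])
qed

text \<open>
  The expected proportion of the indices in \<open>{1..4^k}\<close> that belong to blocks of the first \<open>r\<close> indices is
  at least \<open>(1 - r / 4^k) * hit r\<close>.
\<close>
lemma hit_le_expected_mass: "hit r \<le> expectation (\<lambda>w. \<Sum>j\<in>{1..r}. mass j w)"
proof -
  have lim: "(\<lambda>k. expectation (\<lambda>w. \<Sum>j\<in>{1..r}. block_freq k j w)) \<longlonglongrightarrow> expectation (\<lambda>w. \<Sum>j\<in>{1..r}. mass j w)"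
  proof (rule integral_dominated_convergence[where w = "\<lambda>_. 1"])
    show "AE w in M. (\<lambda>k. \<Sum>j\<in>{1..r}. block_freq k j w) \<longlonglongrightarrow> (\<Sum>j\<in>{1..r}. mass j w)"
      using block_freq_tendsto by eventually_elim (auto intro!: tendsto_sum)
    show "AE w in M. norm (\<Sum>j\<in>{1..r}. block_freq k j w) \<le> 1" for k
      using sum_block_freq_le_1 by (auto simp: sum_nonneg block_freq_bounds)
  qed simp_all
  have bound: "(1 - r / 4^k) * hit r \<le> expectation (\<lambda>w. \<Sum>j\<in>{1..r}. block_freq k j w)" for k
  proof -
    let ?P = "\<lambda>i w. \<exists>j\<in>{1..r}. Z i w = Z j w"
    have int: "integrable M (\<lambda>w. of_bool (?P i w) :: real)" for i
      by (rule integrable_const_bound[of _ 1]) auto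
    have "real (4^k - r) * hit r = (\<Sum>i\<in>{r<..4^k}. hit r)" by simp
    also have "\<dots> = (\<Sum>i\<in>{r<..4^k}. prob {w\<in>space M. ?P i w})"
      by (intro sum.cong refl prob_hit[symmetric]) auto
    also have "\<dots> \<le> (\<Sum>i\<in>{1..4^k}. prob {w\<in>space M. ?P i w})"
      by (intro sum_mono2) auto
    also have "\<dots> = (\<Sum>i\<in>{1..4^k}. expectation (\<lambda>w. of_bool (?P i w)))"
      by (intro sum.cong refl expectation_of_bool[symmetric])
    also have "\<dots> = expectation (\<lambda>w. \<Sum>i\<in>{1..4^k}. of_bool (?P i w))"
      by (intro Bochner_Integration.integral_sum[symmetric] int)
    finally have "real (4^k - r) * hit r / 4^k \<le> expectation (\<lambda>w. \<Sum>i\<in>{1..4^k}. of_bool (?P i w)) / 4^k"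
      by (intro divide_right_mono) auto
    also have "\<dots> = expectation (\<lambda>w. \<Sum>j\<in>{1..r}. block_freq k j w)"
      unfolding sum_block_freq by simp
    finally have *: "real (4^k - r) * hit r / 4^k \<le> expectation (\<lambda>w. \<Sum>j\<in>{1..r}. block_freq k j w)" .
    have "(1 - r / 4^k) * 4^k \<le> real (4^k - r)"
      by (cases "r \<le> 4^k") (auto simp: field_simps of_nat_diff)
    then have "(1 - r / 4^k) \<le> real (4^k - r) / 4^k"
      by (simp add: pos_le_divide_eq)
    then have "(1 - r / 4^k) * hit r \<le> real (4^k - r) / 4^k * hit r"
      by (intro mult_right_mono) (auto simp: hit_def)
    then show ?thesis using * by simp
  qed
  have "(\<lambda>k. (1 - r / 4^k) * hit r) \<longlonglongrightarrow> (1 - 0) * hit r"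
    by (intro tendsto_intros LIMSEQ_divide_realpow_zero) simp
  then have "(1 - 0) * hit r \<le> expectation (\<lambda>w. \<Sum>j\<in>{1..r}. mass j w)"
    by (rule LIMSEQ_le[OF _ lim]) (use bound in blast)
  then show ?thesis by simp
qed

text \<open>The blocks almost surely carry the whole mass: this is where regularity is used.\<close>
lemma AE_mass_sums_1: "AE w in M. (\<lambda>r. \<Sum>j\<in>{1..r}. mass j w) \<longlonglongrightarrow> 1"
proof -
  define S where "S w = lim (\<lambda>r. \<Sum>j\<in>{1..r}. mass j w)" for w
  have [measurable]: "S \<in> borel_measurable M" unfolding S_def by measurable
  have conv: "AE w in M. (\<lambda>r. \<Sum>j\<in>{1..r}. mass j w) \<longlonglongrightarrow> S w"
    using AE_sum_mass_le_1
  proof eventually_elim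
    case (elim w)
    have "incseq (\<lambda>r. \<Sum>j\<in>{1..r}. mass j w)"
      by (intro incseq_SucI) (simp add: mass_nonneg)
    then have "convergent (\<lambda>r. \<Sum>j\<in>{1..r}. mass j w)"
      using elim by (metis incseq_convergent convergentI)
    then show ?case by (simp add: S_def convergent_LIMSEQ_iff)
  qed
  have S_le: "AE w in M. S w \<le> 1 \<and> 0 \<le> S w"
    using conv AE_sum_mass_le_1
  proof eventually_elim
    case (elim w)
    then show ?case
      by (intro conjI LIMSEQ_le_const2[OF elim(1)] LIMSEQ_le_const[OF elim(1)])
         (auto simp: sum_nonneg mass_nonneg)
  qed
  have intS: "integrable M S"
    by (rule integrable_const_bound[of _ 1]) (use S_le in auto)
  have "(\<lambda>r. expectation (\<lambda>w. \<Sum>j\<in>{1..r}. mass j w)) \<longlonglongrightarrow> expectation S"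
  proof (rule integral_dominated_convergence[where w = "\<lambda>_. 1"])
    show "AE w in M. norm (\<Sum>j\<in>{1..r}. mass j w) \<le> 1" for r
      using AE_sum_mass_le_1 by eventually_elim (simp add: sum_nonneg mass_nonneg)
  qed (use conv in simp_all)
  then have "1 \<le> expectation S"
    by (rule LIMSEQ_le[OF hit_tendsto]) (use hit_le_expected_mass in blast)
  moreover have "0 \<le> expectation (\<lambda>w. 1 - S w)"
    using S_le by (intro integral_nonneg_AE) auto
  ultimately have "expectation (\<lambda>w. 1 - S w) = 0" using intS by (simp add: prob_space)
  then have "AE w in M. 1 - S w = 0"
    using intS S_le by (subst (asm) integral_nonneg_eq_0_iff_AE) auto
  with conv show ?thesis by eventually_elim auto
qed

end


section \<open>Sampling with replacement\<close>

lemma sum_of_bool_card: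
  "finite A \<Longrightarrow> (\<Sum>i\<in>A. of_bool (P i)) = real (card {i\<in>A. P i})"
proof -
  assume "finite A"
  moreover have "{i\<in>A. P i} = A \<inter> {i. P i}" by blast
  ultimately show ?thesis by simp
qed

lemma card_collisions:
  assumes "finite I" "finite T" "a \<in> I" "b \<in> I" "a \<noteq> b"
  shows "card {i\<in>I \<rightarrow>\<^sub>E T. i a = i b} * card T \<le> card T ^ card I"
proof -
  let ?C = "{i\<in>I \<rightarrow>\<^sub>E T. i a = i b}"
  have "inj_on (\<lambda>(i, t). i(b := t)) (?C \<times> T)"
  proof (rule inj_onI, clarify)
    fix i t i' t' assume *: "i a = i b" "i' a = i' b" "i(b := t) = i'(b := t')"
    have upd: "(if x = b then t else i x) = (if x = b then t' else i' x)" for x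
      using fun_cong[OF *(3), of x] by (simp only: fun_upd_apply)
    have "t = t'" using upd[of b] by simp
    moreover have "i x = i' x" for x
      using upd[of x] upd[of a] *(1,2) assms(5) by (cases "x = b") auto
    ultimately show "i = i' \<and> t = t'" by auto
  qed
  moreover have "(\<lambda>(i, t). i(b := t)) ` (?C \<times> T) \<subseteq> I \<rightarrow>\<^sub>E T"
    using assms by (auto simp: PiE_iff extensional_def)
  moreover have "finite (I \<rightarrow>\<^sub>E T)" using assms by (intro finite_PiE) auto
  ultimately have "card (?C \<times> T) \<le> card (I \<rightarrow>\<^sub>E T)" by (rule card_inj_on_le)
  then show ?thesis using assms by (simp add: card_cartesian_product card_funcsetE)
qed

text \<open>A map chosen uniformly at random is rarely non-injective.\<close>
lemma card_not_injective:
  assumes "finite I" "finite T" "T \<noteq> {}"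
  shows "real (card {i\<in>I \<rightarrow>\<^sub>E T. \<not> inj_on i I}) / card T ^ card I \<le> (card I)\<^sup>2 / card T"
proof -
  let ?C = "\<lambda>(a, b). {i\<in>I \<rightarrow>\<^sub>E T. i a = i b}"
  let ?P = "{(a, b). a \<in> I \<and> b \<in> I \<and> a \<noteq> b}"
  have fin: "finite ?P" "finite (I \<rightarrow>\<^sub>E T)" "?P \<subseteq> I \<times> I"
    using assms by (auto intro!: finite_PiE finite_subset[of ?P "I \<times> I"])
  have T: "0 < real (card T)" using assms by (simp add: card_gt_0_iff)
  have "{i\<in>I \<rightarrow>\<^sub>E T. \<not> inj_on i I} \<subseteq> (\<Union>p\<in>?P. ?C p)"
    by (auto simp: inj_on_def)
  then have "card {i\<in>I \<rightarrow>\<^sub>E T. \<not> inj_on i I} \<le> card (\<Union>p\<in>?P. ?C p)"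
    using fin by (intro card_mono) (auto intro: finite_subset)
  also have "\<dots> \<le> (\<Sum>p\<in>?P. card (?C p))" by (rule card_UN_le[OF fin(1)])
  finally have "real (card {i\<in>I \<rightarrow>\<^sub>E T. \<not> inj_on i I}) \<le> (\<Sum>p\<in>?P. real (card (?C p)))"
    by (simp only: of_nat_sum[symmetric] of_nat_le_iff)
  also have "\<dots> \<le> (\<Sum>p\<in>?P. real (card T) ^ card I / card T)"
  proof (rule sum_mono, clarify)
    fix a b assume "a \<in> I" "b \<in> I" "a \<noteq> b"
    from card_collisions[OF assms(1,2) this]
    have "real (card {i\<in>I \<rightarrow>\<^sub>E T. i a = i b} * card T) \<le> real (card T ^ card I)"
      by (rule of_nat_mono)
    then show "real (card {i\<in>I \<rightarrow>\<^sub>E T. i a = i b}) \<le> real (card T) ^ card I / card T"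
      using T by (simp add: pos_le_divide_eq)
  qed
  also have "\<dots> = card ?P * (real (card T) ^ card I / card T)" by simp
  also have "\<dots> \<le> (card I)\<^sup>2 * (real (card T) ^ card I / card T)"
  proof (rule mult_right_mono)
    have "card ?P \<le> card (I \<times> I)" using assms by (intro card_mono fin) auto
    then show "real (card ?P) \<le> (card I)\<^sup>2"
      by (simp only: card_cartesian_product power2_eq_square of_nat_le_iff)
  qed simp
  finally show ?thesis using T by (simp add: field_simps)
qed

context exchangeable_allocation
begin

lemma first_in_block_inj:
  assumes "first_in_block a w" "first_in_block b w" "Z a w = Z b w"
  shows "a = b"
  using assms unfolding first_in_block_def by (metis atLeastLessThan_iff linorder_neqE_nat)

lemma freq_eq_card: "freq n j w = real (card {i\<in>{1..n}. Z i w = Z j w}) / n"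
  by (simp only: freq_def sum_of_bool_card[OF finite_atLeastAtMost])

text \<open>The allocation of \<open>{1..N}\<close> in which \<open>l\<close> takes the label set of the index \<open>i l\<close>.\<close>
definition sampled :: "(nat \<Rightarrow> nat) \<Rightarrow> nat \<Rightarrow> 'w \<Rightarrow> nat set multiset" where
  "sampled i N w = alloc_of (\<lambda>l. Z (i l) w) N"

lemma pred_sampled [measurable]: "Measurable.pred M (\<lambda>w. Q (sampled i N w))"
  unfolding sampled_def by (rule pred_reindex)

text \<open>
  Drawing \<open>N\<close> indices independently and uniformly from \<open>{1..4^k}\<close> draws their blocks independently with
  the probabilities \<open>block_freq k\<close>. The left side counts only the outcomes whose blocks all have a
  least index in \<open>{1..K}\<close>, whence the inequality.
\<close>
lemma block_sampling_le_index_sampling: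
  fixes n :: nat
  assumes n: "n = 4^k"
  shows "(\<Sum>\<phi>\<in>{1..N} \<rightarrow>\<^sub>E {1..K}. (\<Prod>l\<in>{1..N}. block_freq k (\<phi> l) w) * of_bool (Q (sampled \<phi> N w)))
    \<le> (\<Sum>i\<in>{1..N} \<rightarrow>\<^sub>E {1..n}. of_bool (Q (sampled i N w))) / n ^ N"
proof -
  let ?A = "{1..N} \<rightarrow>\<^sub>E {1..K}"
  let ?B = "{\<phi>\<in>?A. (\<forall>l\<in>{1..N}. first_in_block (\<phi> l) w) \<and> Q (sampled \<phi> N w)}"
  let ?C = "{i\<in>{1..N} \<rightarrow>\<^sub>E {1..n}. Q (sampled i N w)}"
  \<comment> \<open>The index tuples whose entries lie in the blocks prescribed by \<open>\<phi>\<close>.\<close>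
  define T where "T \<phi> = (\<Pi>\<^sub>E l\<in>{1..N}. {i\<in>{1..n}. Z i w = Z (\<phi> l) w})" for \<phi> :: "nat \<Rightarrow> nat"
  have fin: "finite ?A" "finite ({1..N} \<rightarrow>\<^sub>E {1..n})" by (auto intro!: finite_PiE)
  have finT: "finite (T \<phi>)" for \<phi> unfolding T_def by (intro finite_PiE) auto
  have "(\<Sum>\<phi>\<in>?A. (\<Prod>l\<in>{1..N}. block_freq k (\<phi> l) w) * of_bool (Q (sampled \<phi> N w)))
      = (\<Sum>\<phi>\<in>?B. (\<Prod>l\<in>{1..N}. block_freq k (\<phi> l) w) * of_bool (Q (sampled \<phi> N w)))"
  proof (rule sum.mono_neutral_right[OF fin(1)])
    show "\<forall>\<phi>\<in>?A - ?B. (\<Prod>l\<in>{1..N}. block_freq k (\<phi> l) w) * of_bool (Q (sampled \<phi> N w)) = 0"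
    proof
      fix \<phi> assume "\<phi> \<in> ?A - ?B"
      then consider l where "l \<in> {1..N}" "\<not> first_in_block (\<phi> l) w" | "\<not> Q (sampled \<phi> N w)"
        by blast
      then show "(\<Prod>l\<in>{1..N}. block_freq k (\<phi> l) w) * of_bool (Q (sampled \<phi> N w)) = 0"
      proof cases
        case (1 l)
        then have "(\<Prod>l\<in>{1..N}. block_freq k (\<phi> l) w) = 0"
          by (intro prod_zero bexI[of _ l]) (auto simp: block_freq_def)
        then show ?thesis by simp
      qed simp
    qed
  qed blast
  also have "\<dots> = (\<Sum>\<phi>\<in>?B. real (card (T \<phi>)) / n ^ N)"
  proof (intro sum.cong refl)
    fix \<phi> assume \<phi>: "\<phi> \<in> ?B"
    have "(\<Prod>l\<in>{1..N}. block_freq k (\<phi> l) w) = (\<Prod>l\<in>{1..N}. real (card {i\<in>{1..n}. Z i w = Z (\<phi> l) w}) / n)"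
      using \<phi> by (intro prod.cong refl) (simp add: block_freq_def freq_eq_card n)
    also have "\<dots> = real (card (T \<phi>)) / n ^ N"
      by (simp add: prod_dividef T_def card_PiE)
    finally show "(\<Prod>l\<in>{1..N}. block_freq k (\<phi> l) w) * of_bool (Q (sampled \<phi> N w)) = real (card (T \<phi>)) / n ^ N"
      using \<phi> by simp
  qed
  also have "\<dots> = real (card (\<Union>\<phi>\<in>?B. T \<phi>)) / n ^ N"
  proof -
    have "card (\<Union>\<phi>\<in>?B. T \<phi>) = (\<Sum>\<phi>\<in>?B. card (T \<phi>))"
    proof (rule card_UN_disjoint)
      show "\<forall>\<phi>\<in>?B. \<forall>\<psi>\<in>?B. \<phi> \<noteq> \<psi> \<longrightarrow> T \<phi> \<inter> T \<psi> = {}"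
      proof (intro ballI impI, rule ccontr)
        fix \<phi> \<psi> assume *: "\<phi> \<in> ?B" "\<psi> \<in> ?B" "\<phi> \<noteq> \<psi>" "T \<phi> \<inter> T \<psi> \<noteq> {}"
        then obtain i where i: "i \<in> T \<phi>" "i \<in> T \<psi>" by blast
        have "\<phi> l = \<psi> l" if "l \<in> {1..N}" for l
        proof (rule first_in_block_inj)
          show "first_in_block (\<phi> l) w" "first_in_block (\<psi> l) w" using * that by auto
          show "Z (\<phi> l) w = Z (\<psi> l) w" using i that unfolding T_def PiE_iff by (metis (mono_tags, lifting) mem_Collect_eq)
        qed
        moreover have "\<phi> \<in> ?A" "\<psi> \<in> ?A" using * by auto
        ultimately have "\<phi> = \<psi>" by (meson PiE_ext)
        with * show False by simp
      qed
    qed (use fin finT in auto)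
    then show ?thesis by (simp add: sum_divide_distrib)
  qed
  also have "\<dots> \<le> real (card ?C) / n ^ N"
  proof (intro divide_right_mono of_nat_mono card_mono)
    show "(\<Union>\<phi>\<in>?B. T \<phi>) \<subseteq> ?C"
    proof (rule UN_least, rule subsetI)
      fix \<phi> i assume \<phi>: "\<phi> \<in> ?B" and i: "i \<in> T \<phi>"
      then have "sampled i N w = sampled \<phi> N w"
        unfolding sampled_def by (intro alloc_of_cong) (auto simp: T_def PiE_iff)
      moreover have "i \<in> {1..N} \<rightarrow>\<^sub>E {1..n}" using i by (auto simp: T_def PiE_iff)
      ultimately show "i \<in> ?C" using \<phi> by simp
    qed
  qed (use fin in auto)
  also have "real (card ?C) = (\<Sum>i\<in>{1..N} \<rightarrow>\<^sub>E {1..n}. of_bool (Q (sampled i N w)))"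
    by (simp only: sum_of_bool_card[OF fin(2)])
  finally show ?thesis .
qed

text \<open>Index tuples without repetition induce an allocation with the law of \<open>f N\<close>.\<close>
lemma prob_index_sampling:
  assumes n: "n = 4^k"
  shows "expectation (\<lambda>w. (\<Sum>i\<in>{1..N} \<rightarrow>\<^sub>E {1..n}. of_bool (Q (sampled i N w))) / real (n ^ N))
    \<le> prob {w\<in>space M. Q (f N w)} + (real N)\<^sup>2 / real n"
proof -
  let ?A = "{1..N} \<rightarrow>\<^sub>E {1..n::nat}"
  let ?p = "prob {w\<in>space M. Q (f N w)}"
  have fin: "finite ?A" by (auto intro!: finite_PiE)
  have n0: "0 < real n ^ N" using n by simp
  have card: "card ?A = n ^ N" by (simp add: card_funcsetE)
  have int: "integrable M (\<lambda>w. of_bool (Q (sampled i N w)) :: real)" for i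
    by (rule integrable_const_bound[of _ 1]) auto
  have "expectation (\<lambda>w. (\<Sum>i\<in>?A. of_bool (Q (sampled i N w))) / real (n ^ N)) =
      (\<Sum>i\<in>?A. expectation (\<lambda>w. of_bool (Q (sampled i N w)))) / real (n ^ N)"
    using int by (simp add: Bochner_Integration.integral_sum)
  also have "\<dots> = (\<Sum>i\<in>?A. prob {w\<in>space M. Q (sampled i N w)}) / real (n ^ N)"
    by (simp only: expectation_of_bool)
  also have "\<dots> \<le> (\<Sum>i\<in>?A. ?p + of_bool (\<not> inj_on i {1..N})) / real (n ^ N)"
  proof (intro divide_right_mono sum_mono)
    fix i assume i: "i \<in> ?A"
    show "prob {w\<in>space M. Q (sampled i N w)} \<le> ?p + of_bool (\<not> inj_on i {1..N})"
    proof (cases "inj_on i {1..N}")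
      case True
      then have "prob {w\<in>space M. Q (sampled i N w)} = ?p"
        unfolding sampled_def by (rule prob_reindex) (use i in \<open>auto simp: PiE_iff\<close>)
      then show ?thesis by simp
    next
      case False
      then show ?thesis using prob_le_1 by (simp add: add_increasing)
    qed
  qed simp
  also have "\<dots> = ?p + real (card {i\<in>?A. \<not> inj_on i {1..N}}) / real (n ^ N)"
    using n0 card by (simp only: sum.distrib sum_of_bool_card[OF fin] add_divide_distrib) simp
  also have "\<dots> \<le> ?p + (real N)\<^sup>2 / real n"
    using card_not_injective[of "{1..N}" "{1..n}"] n by simp
  finally show ?thesis .
qed

text \<open>Let \<open>k\<close> tend to infinity in the two previous estimates.\<close>
lemma prob_block_sampling:
  "expectation (\<lambda>w. \<Sum>\<phi>\<in>{1..N} \<rightarrow>\<^sub>E {1..K}. (\<Prod>l\<in>{1..N}. mass (\<phi> l) w) * of_bool (Q (sampled \<phi> N w)))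
    \<le> prob {w\<in>space M. Q (f N w)}"
proof -
  let ?A = "{1..N} \<rightarrow>\<^sub>E {1..K::nat}"
  let ?g = "\<lambda>k w. \<Sum>\<phi>\<in>?A. (\<Prod>l\<in>{1..N}. block_freq k (\<phi> l) w) * of_bool (Q (sampled \<phi> N w))"
  let ?h = "\<lambda>w. \<Sum>\<phi>\<in>?A. (\<Prod>l\<in>{1..N}. mass (\<phi> l) w) * of_bool (Q (sampled \<phi> N w))"
  have term_le: "0 \<le> (\<Prod>l\<in>{1..N}. block_freq k (\<phi> l) w)" "(\<Prod>l\<in>{1..N}. block_freq k (\<phi> l) w) \<le> 1" for k \<phi> w
    using block_freq_bounds by (auto intro!: prod_nonneg prod_le_1)
  have g_le: "norm (?g k w) \<le> card ?A" for k w
  proof -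
    have "?g k w \<le> (\<Sum>\<phi>\<in>?A. 1)"
      using term_le by (intro sum_mono) (simp add: of_bool_def)
    moreover have "0 \<le> ?g k w" using term_le by (intro sum_nonneg mult_nonneg_nonneg) auto
    ultimately show ?thesis by simp
  qed
  have lim: "(\<lambda>k. expectation (?g k)) \<longlonglongrightarrow> expectation ?h"
  proof (rule integral_dominated_convergence[where w = "\<lambda>_. real (card ?A)"])
    show "AE w in M. (\<lambda>k. ?g k w) \<longlonglongrightarrow> ?h w"
      using block_freq_tendsto
      by eventually_elim (intro tendsto_intros; auto simp: PiE_iff)
    show "AE w in M. norm (?g k w) \<le> real (card ?A)" for k using g_le by auto
  qed simp_all
  have bound: "expectation (?g k) \<le> prob {w\<in>space M. Q (f N w)} + (real N)\<^sup>2 / 4^k" for k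
  proof -
    have "expectation (?g k) \<le> expectation
        (\<lambda>w. (\<Sum>i\<in>{1..N} \<rightarrow>\<^sub>E {1..4^k}. of_bool (Q (sampled i N w))) / real ((4^k) ^ N))"
    proof (rule integral_mono)
      show "integrable M (?g k)"
        by (rule integrable_const_bound[of _ "card ?A"]) (use g_le in auto)
      have int: "integrable M (\<lambda>w. of_bool (Q (sampled i N w)) :: real)" for i
        by (rule integrable_const_bound[of _ 1]) auto
      show "integrable M (\<lambda>w. (\<Sum>i\<in>{1..N} \<rightarrow>\<^sub>E {1..4^k}. of_bool (Q (sampled i N w))) / real ((4^k) ^ N))"
        by (intro integrable_divide Bochner_Integration.integrable_sum int)
    qed (use block_sampling_le_index_sampling[of "4^k" k, OF refl] in simp)
    also have "\<dots> \<le> prob {w\<in>space M. Q (f N w)} + (real N)\<^sup>2 / real (4^k)"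
      by (rule prob_index_sampling[OF refl])
    finally show ?thesis by simp
  qed
  have "(\<lambda>k. prob {w\<in>space M. Q (f N w)} + (real N)\<^sup>2 / 4^k) \<longlonglongrightarrow> prob {w\<in>space M. Q (f N w)} + 0"
    by (intro tendsto_intros LIMSEQ_divide_realpow_zero) simp
  from LIMSEQ_le[OF lim this] show ?thesis using bound by auto
qed

end


section \<open>The paintbox\<close>

text \<open>The uniform distribution on the unit interval.\<close>
definition unif :: "real measure" where
  "unif = uniform_measure lborel {0..1}"

text \<open>The law of a sequence of independent uniform variables.\<close>
definition draws :: "(nat \<Rightarrow> real) measure" where
  "draws = PiM UNIV (\<lambda>_. unif)"

lemma sets_unif [measurable_cong, simp]: "sets unif = sets borel"
  by (simp add: unif_def)

lemma space_unif [simp]: "space unif = UNIV"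
  by (simp add: unif_def)

lemma prob_space_unif: "prob_space unif"
  unfolding unif_def by (rule prob_space_uniform_measure) auto

interpretation draws: product_prob_space "\<lambda>_. unif" "UNIV :: nat set"
  using prob_space_unif by (simp add: product_prob_space_def product_prob_space_axioms_def
      product_sigma_finite_def prob_space_imp_sigma_finite)

lemma prob_space_draws: "prob_space draws"
  unfolding draws_def by unfold_locales

lemma space_draws [simp]: "space draws = UNIV"
  by (simp add: draws_def space_PiM)

lemma measurable_draw [measurable]: "(\<lambda>u. u n) \<in> borel_measurable draws"
proof -
  have "(\<lambda>u. u n) \<in> measurable draws unif"
    unfolding draws_def by (rule measurable_component_singleton) simp
  then show ?thesis by (simp cong: measurable_cong_sets)
qed

lemma prod_mono_ennreal:
  fixes f g :: "'a \<Rightarrow> ennreal"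
  assumes "\<And>i. i \<in> A \<Longrightarrow> f i \<le> g i"
  shows "prod f A \<le> prod g A"
  using assms by (induction A rule: infinite_finite_induct) (auto intro: mult_mono)

lemma emeasure_unif_interval_le:
  assumes "a \<le> b" "A \<in> sets borel" "A \<subseteq> {a..<b}"
  shows "emeasure unif A \<le> ennreal (b - a)"
proof -
  have "emeasure unif A = emeasure lborel ({0..1} \<inter> A) / emeasure lborel {0..1::real}"
    unfolding unif_def using assms by (intro emeasure_uniform_measure) auto
  also have "\<dots> = emeasure lborel ({0..1} \<inter> A)" by (simp add: divide_ennreal_def)
  also have "\<dots> \<le> emeasure lborel {a..<b}" using assms by (intro emeasure_mono) auto
  also have "\<dots> = ennreal (b - a)" using assms by simp
  finally show ?thesis .
qed

lemma AE_unif: "AE x in unif. 0 \<le> x \<and> x < 1"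
proof -
  have "AE x in lborel. x \<noteq> (1::real)" by (rule AE_lborel_singleton)
  then have "AE x in lborel. x \<in> {0..1} \<longrightarrow> 0 \<le> x \<and> x < (1::real)" by eventually_elim auto
  then show ?thesis unfolding unif_def by (intro AE_uniform_measureI) auto
qed

lemma AE_draws: "AE u in draws. \<forall>n. 0 \<le> u n \<and> u n < 1"
  unfolding AE_all_countable draws_def using AE_unif by (auto intro: draws.AE_component)

context exchangeable_allocation
begin

text \<open>
  The unit interval is cut into consecutive half-open intervals of lengths \<open>mass 1, mass 2, ...\<close>.
\<close>
definition cumulative_mass :: "nat \<Rightarrow> 'w \<Rightarrow> real" where
  "cumulative_mass j w = (\<Sum>i\<in>{1..j}. mass i w)"

text \<open>
  The interval of the index \<open>j \<ge> 1\<close>. It is empty unless \<open>j\<close> is the least index of its block. The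
  intersection with the unit interval only matters on the null event that the masses sum to more than 1.
\<close>
definition piece :: "nat \<Rightarrow> 'w \<Rightarrow> real set" where
  "piece j w = {x. 0 \<le> x \<and> x \<le> 1 \<and> cumulative_mass (j - 1) w \<le> x \<and> x < cumulative_mass j w}"

text \<open>The index whose interval contains \<open>x\<close>. The value 0, whose label set is empty, is taken outside all of them.\<close>
definition pick :: "'w \<Rightarrow> real \<Rightarrow> nat" where
  "pick w x = (if \<exists>j\<ge>1. x \<in> piece j w then LEAST j. 1 \<le> j \<and> x \<in> piece j w else 0)"

text \<open>The random set \<open>C k\<close> of the theorem: the points whose block carries the label \<open>k\<close>.\<close>
definition paint :: "nat \<Rightarrow> 'w \<Rightarrow> real set" where
  "paint k w = (\<Union>j\<in>{j. 1 \<le> j \<and> k \<in> Z j w}. piece j w)"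

lemma cumulative_mass_mono: "i \<le> j \<Longrightarrow> cumulative_mass i w \<le> cumulative_mass j w"
  unfolding cumulative_mass_def by (intro sum_mono2) (auto simp: mass_nonneg)

lemma cumulative_mass_Suc: "cumulative_mass (Suc j) w - cumulative_mass j w = mass (Suc j) w"
  by (simp add: cumulative_mass_def)

lemma cumulative_mass_measurable [measurable]: "cumulative_mass j \<in> borel_measurable M"
  unfolding cumulative_mass_def by measurable

lemma pieces_disjoint:
  assumes "1 \<le> i" "1 \<le> j" "x \<in> piece i w" "x \<in> piece j w"
  shows "i = j"
proof -
  have "\<not> i < j" if "x \<in> piece i w" "x \<in> piece j w" for i j
  proof
    assume "i < j"
    then have "cumulative_mass i w \<le> cumulative_mass (j - 1) w" by (intro cumulative_mass_mono) simp
    then show False using that by (auto simp: piece_def)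
  qed
  then show ?thesis using assms by (meson linorder_neqE_nat)
qed

lemma pick_eq_iff:
  assumes "1 \<le> j"
  shows "pick w x = j \<longleftrightarrow> x \<in> piece j w"
proof
  assume "x \<in> piece j w"
  then have "(LEAST j. 1 \<le> j \<and> x \<in> piece j w) = j"
    using assms pieces_disjoint[of _ j x w] by (intro Least_equality) (auto simp: eq_iff)
  then show "pick w x = j" using \<open>x \<in> piece j w\<close> assms by (auto simp: pick_def)
next
  assume *: "pick w x = j"
  then have ex: "\<exists>j\<ge>1. x \<in> piece j w" using assms by (auto simp: pick_def split: if_splits)
  then show "x \<in> piece j w" using LeastI_ex[of "\<lambda>j. 1 \<le> j \<and> x \<in> piece j w"] * by (auto simp: pick_def)
qed

lemma paint_iff: "x \<in> paint k w \<longleftrightarrow> k \<in> Z (pick w x) w"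
proof
  assume "x \<in> paint k w"
  then obtain j where j: "1 \<le> j" "k \<in> Z j w" "x \<in> piece j w" by (auto simp: paint_def)
  then have "pick w x = j" using pick_eq_iff by blast
  then show "k \<in> Z (pick w x) w" using j by simp
next
  assume k: "k \<in> Z (pick w x) w"
  then have "1 \<le> pick w x" by (cases "pick w x") (auto simp: labels_def)
  with k show "x \<in> paint k w" using pick_eq_iff[of "pick w x" w x] by (auto simp: paint_def)
qed

lemma paint_is_union_of_intervals: "countable_union_of_intervals (paint k w)"
proof -
  let ?I = "\<lambda>j. if 1 \<le> j \<and> k \<in> Z j w then piece j w else {}"
  have "is_interval (piece j w)" for j
    by (auto simp: is_interval_1 piece_def)
  then have I: "is_interval (?I j)" "?I j \<subseteq> {0..1}" for j by (auto simp: piece_def)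
  have "paint k w = (\<Union>j. ?I j)" by (auto simp: paint_def)
  then show ?thesis
    unfolding countable_union_of_intervals_def using I by (intro exI[of _ ?I] conjI allI)
qed

lemma pick_measurable:
  assumes [measurable]: "g \<in> measurable R M" "h \<in> borel_measurable R"
  shows "(\<lambda>p. pick (g p) (h p)) \<in> measurable R (count_space UNIV)"
  unfolding pick_def piece_def mem_Collect_eq by measurable

text \<open>The given probability space, which determines the sets \<open>paint k\<close>, times an independent sequence of draws.\<close>
definition paintbox :: "('w \<times> (nat \<Rightarrow> real)) measure" where
  "paintbox = M \<Otimes>\<^sub>M draws"

text \<open>The allocation generated from the draws.\<close>
definition painted_alloc :: "nat \<Rightarrow> 'w \<times> (nat \<Rightarrow> real) \<Rightarrow> nat set multiset" where
  "painted_alloc N p = alloc_of (\<lambda>l. Z (pick (fst p) (snd p l)) (fst p)) N"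

lemma fst_paintbox [measurable]: "fst \<in> measurable paintbox M"
  unfolding paintbox_def by measurable

lemma snd_paintbox [measurable]: "snd \<in> measurable paintbox draws"
  unfolding paintbox_def by measurable

lemma draw_paintbox [measurable]: "(\<lambda>p. snd p n) \<in> borel_measurable paintbox"
  by measurable

lemma prob_space_paintbox: "prob_space paintbox"
  unfolding paintbox_def using prob_space_axioms prob_space_draws by (rule prob_space_pair)

lemma pick_paintbox [measurable]: "(\<lambda>p. pick (fst p) (snd p l)) \<in> measurable paintbox (count_space UNIV)"
  by (rule pick_measurable) measurable

lemma painted_alloc_eq_sampled:
  assumes "\<And>l. l \<in> {1..N} \<Longrightarrow> pick (fst p) (snd p l) = \<phi> l"
  shows "painted_alloc N p = sampled \<phi> N (fst p)"
  unfolding painted_alloc_def sampled_def using assms by (intro alloc_of_cong) simp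

lemma pred_painted_alloc [measurable]: "Measurable.pred paintbox (\<lambda>p. Q (painted_alloc N p))"
proof -
  let ?R = "\<lambda>p. \<exists>\<phi>\<in>{1..N} \<rightarrow>\<^sub>E (UNIV :: nat set).
    (\<forall>l\<in>{1..N}. pick (fst p) (snd p l) = \<phi> l) \<and> Q (sampled \<phi> N (fst p))"
  have "Q (painted_alloc N p) \<longleftrightarrow> ?R p" for p
  proof
    let ?\<phi> = "\<lambda>l\<in>{1..N}. pick (fst p) (snd p l)"
    assume "Q (painted_alloc N p)"
    moreover have "painted_alloc N p = sampled ?\<phi> N (fst p)" by (rule painted_alloc_eq_sampled) simp
    ultimately show "?R p" by (intro bexI[of _ ?\<phi>]) auto
  next
    assume "?R p"
    then obtain \<phi> where \<phi>: "\<forall>l\<in>{1..N}. pick (fst p) (snd p l) = \<phi> l" "Q (sampled \<phi> N (fst p))" by blast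
    then have "painted_alloc N p = sampled \<phi> N (fst p)" by (intro painted_alloc_eq_sampled) blast
    then show "Q (painted_alloc N p)" using \<phi> by simp
  qed
  moreover have "Measurable.pred paintbox ?R"
    unfolding pred_def
  proof (rule sets.sets_Collect_countable_Ex')
    show "countable ({1..N} \<rightarrow>\<^sub>E (UNIV :: nat set))" by (intro countable_PiE) auto
    fix \<phi> :: "nat \<Rightarrow> nat"
    have [measurable]: "Measurable.pred paintbox (\<lambda>p. Q (sampled \<phi> N (fst p)))"
      by (rule measurable_compose[OF fst_paintbox pred_sampled])
    show "{p\<in>space paintbox. (\<forall>l\<in>{1..N}. pick (fst p) (snd p l) = \<phi> l) \<and> Q (sampled \<phi> N (fst p))}
        \<in> sets paintbox"
      by measurable
  qed
  ultimately show ?thesis by simp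
qed

lemma AE_pick_pos: "AE p in paintbox. \<forall>l. 1 \<le> pick (fst p) (snd p l)"
proof -
  interpret D: prob_space draws by (rule prob_space_draws)
  interpret pair_sigma_finite M draws ..
  have mem: "{p \<in> space paintbox. \<forall>l. 1 \<le> pick (fst p) (snd p l)} \<in> sets paintbox"
    by measurable
  have "AE w in M. AE u in draws. \<forall>l. 1 \<le> pick w (u l)"
    using AE_mass_sums_1
  proof eventually_elim
    case (elim w)
    show ?case
      using AE_draws
    proof eventually_elim
      case u: (elim u)
      show ?case
      proof
        fix l
        let ?x = "u l"
        have x: "0 \<le> ?x" "?x < 1" using u by auto
        have "\<exists>r. ?x < cumulative_mass r w"
          using order_tendstoD(1)[OF elim x(2)] unfolding cumulative_mass_def eventually_sequentially by blast
        define r where "r = (LEAST r. ?x < cumulative_mass r w)"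
        have r: "?x < cumulative_mass r w" unfolding r_def using \<open>\<exists>r. _\<close> by (rule LeastI_ex)
        have r0: "r \<noteq> 0" using r x by (auto simp: cumulative_mass_def intro: ccontr)
        then have "\<not> ?x < cumulative_mass (r - 1) w" unfolding r_def by (intro not_less_Least) auto
        then have "?x \<in> piece r w" using r x by (auto simp: piece_def)
        then have "pick w ?x = r" using pick_eq_iff r0 by simp
        then show "1 \<le> pick w ?x" using r0 by simp
      qed
    qed
  qed
  then show ?thesis
    using mem unfolding paintbox_def by (intro AE_pair_measure) auto
qed

text \<open>
  By Fubini, the probability that the draws pick prescribed indices \<open>\<phi> 1, ..., \<phi> N\<close> is, given the
  first coordinate, at most the product of the masses.
\<close>
lemma prob_truncated_painted_alloc:
  "emeasure paintbox {p\<in>space paintbox. Q (painted_alloc N p) \<and> (\<forall>l\<in>{1..N}. 1 \<le> pick (fst p) (snd p l) \<and> pick (fst p) (snd p l) \<le> K)}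
    \<le> ennreal (prob {w\<in>space M. Q (f N w)})"
proof -
  interpret D: prob_space draws by (rule prob_space_draws)
  let ?E = "{p\<in>space paintbox. Q (painted_alloc N p) \<and> (\<forall>l\<in>{1..N}. 1 \<le> pick (fst p) (snd p l) \<and> pick (fst p) (snd p l) \<le> K)}"
  let ?A = "{1..N} \<rightarrow>\<^sub>E {1..K::nat}"
  let ?h = "\<lambda>\<phi> w. (\<Prod>l\<in>{1..N}. mass (\<phi> l) w) * of_bool (Q (sampled \<phi> N w))"
  have finA: "finite ?A" by (auto intro!: finite_PiE)
  have piece_sets: "piece j w \<in> sets borel" for j w unfolding piece_def by measurable
  have piece_le: "emeasure unif (piece j w) \<le> ennreal (mass j w)" if "1 \<le> j" for j w
  proof -
    have "emeasure unif (piece j w) \<le> ennreal (cumulative_mass j w - cumulative_mass (j - 1) w)"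
      using piece_sets by (intro emeasure_unif_interval_le cumulative_mass_mono) (auto simp: piece_def)
    then show ?thesis using cumulative_mass_Suc[of "j - 1" w] that by simp
  qed
  have [measurable]: "?E \<in> sets paintbox" by measurable
  have h_nonneg: "0 \<le> ?h \<phi> w" for \<phi> w by (intro mult_nonneg_nonneg prod_nonneg) (auto simp: mass_nonneg)
  have inner: "emeasure draws (Pair w -` ?E) \<le> ennreal (\<Sum>\<phi>\<in>?A. ?h \<phi> w)" if w: "w \<in> space M" for w
  proof -
    let ?B = "\<lambda>\<phi>. {u\<in>space draws. \<forall>l\<in>{1..N}. u l \<in> piece (\<phi> l) w}"
    let ?A' = "{\<phi>\<in>?A. Q (sampled \<phi> N w)}"
    have "Pair w -` ?E \<subseteq> (\<Union>\<phi>\<in>?A'. ?B \<phi>)"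
    proof
      fix u assume "u \<in> Pair w -` ?E"
      then have u: "Q (painted_alloc N (w, u))" "\<forall>l\<in>{1..N}. pick w (u l) \<in> {1..K}" by auto
      let ?\<phi> = "\<lambda>l\<in>{1..N}. pick w (u l)"
      have "painted_alloc N (w, u) = sampled ?\<phi> N (fst (w, u))"
        by (rule painted_alloc_eq_sampled) simp
      then have A': "?\<phi> \<in> ?A'" using u by auto
      have "u l \<in> piece (?\<phi> l) w" if "l \<in> {1..N}" for l
        using u(2) that pick_eq_iff[of "pick w (u l)" w "u l"] by simp
      then show "u \<in> (\<Union>\<phi>\<in>?A'. ?B \<phi>)" by (intro UN_I[OF A']) simp
    qed
    moreover have B_sets: "?B \<phi> \<in> sets draws" for \<phi>
      using piece_sets by measurable
    ultimately have "emeasure draws (Pair w -` ?E) \<le> emeasure draws (\<Union>\<phi>\<in>?A'. ?B \<phi>)"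
      using finA by (intro emeasure_mono sets.finite_UN) auto
    also have "\<dots> \<le> (\<Sum>\<phi>\<in>?A'. emeasure draws (?B \<phi>))"
      using finA B_sets by (intro emeasure_subadditive_finite) auto
    also have "\<dots> \<le> (\<Sum>\<phi>\<in>?A'. ennreal (?h \<phi> w))"
    proof (rule sum_mono)
      fix \<phi> assume \<phi>: "\<phi> \<in> ?A'"
      have "emeasure draws (?B \<phi>) = (\<Prod>l\<in>{1..N}. emeasure unif (piece (\<phi> l) w))"
        unfolding draws_def using piece_sets by (intro draws.emeasure_PiM_Collect) auto
      also have "\<dots> \<le> (\<Prod>l\<in>{1..N}. ennreal (mass (\<phi> l) w))"
        using \<phi> by (intro prod_mono_ennreal) (auto simp: PiE_iff intro!: piece_le)
      also have "\<dots> = ennreal (?h \<phi> w)"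
        using \<phi> by (simp add: prod_ennreal mass_nonneg)
      finally show "emeasure draws (?B \<phi>) \<le> ennreal (?h \<phi> w)" .
    qed
    also have "\<dots> = ennreal (\<Sum>\<phi>\<in>?A'. ?h \<phi> w)"
      by (rule sum_ennreal) (rule h_nonneg)
    also have "\<dots> \<le> ennreal (\<Sum>\<phi>\<in>?A. ?h \<phi> w)"
      using finA h_nonneg by (intro ennreal_leI sum_mono2) auto
    finally show ?thesis .
  qed
  have mass_le: "AE w in M. \<forall>j\<ge>1. mass j w \<le> 1"
    using AE_sum_mass_le_1
  proof eventually_elim
    case (elim w)
    show ?case
    proof (intro allI impI)
      fix j :: nat assume "1 \<le> j"
      then have "mass j w \<le> (\<Sum>i\<in>{1..j}. mass i w)"
        by (intro member_le_sum) (auto simp: mass_nonneg)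
      then show "mass j w \<le> 1" using elim by (meson order_trans)
    qed
  qed
  have int: "integrable M (?h \<phi>)" if "\<phi> \<in> ?A" for \<phi>
  proof (rule integrable_const_bound[of _ 1])
    show "AE w in M. norm (?h \<phi> w) \<le> 1"
      using mass_le
    proof eventually_elim
      case (elim w)
      have "(\<Prod>l\<in>{1..N}. mass (\<phi> l) w) \<le> 1"
        using elim that by (intro prod_le_1) (auto simp: PiE_iff mass_nonneg)
      moreover have "0 \<le> (\<Prod>l\<in>{1..N}. mass (\<phi> l) w)" by (simp add: prod_nonneg mass_nonneg)
      ultimately show ?case by simp
    qed
  qed measurable
  have "emeasure paintbox ?E = (\<integral>\<^sup>+w. emeasure draws (Pair w -` ?E) \<partial>M)"
    using \<open>?E \<in> sets paintbox\<close> unfolding paintbox_def by (intro D.emeasure_pair_measure_alt) simp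
  also have "\<dots> \<le> (\<integral>\<^sup>+w. ennreal (\<Sum>\<phi>\<in>?A. ?h \<phi> w) \<partial>M)"
    by (rule nn_integral_mono) (rule inner)
  also have "\<dots> = ennreal (expectation (\<lambda>w. \<Sum>\<phi>\<in>?A. ?h \<phi> w))"
    using int h_nonneg by (intro nn_integral_eq_integral Bochner_Integration.integrable_sum AE_I2 sum_nonneg) auto
  also have "\<dots> \<le> ennreal (prob {w\<in>space M. Q (f N w)})"
    by (intro ennreal_leI prob_block_sampling)
  finally show ?thesis .
qed

lemma prob_painted_alloc_le:
  "measure paintbox {p\<in>space paintbox. Q (painted_alloc N p)} \<le> prob {w\<in>space M. Q (f N w)}"
proof -
  interpret P: prob_space paintbox by (rule prob_space_paintbox)
  define E where "E K = {p\<in>space paintbox. Q (painted_alloc N p) \<and>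
    (\<forall>l\<in>{1..N}. 1 \<le> pick (fst p) (snd p l) \<and> pick (fst p) (snd p l) \<le> K)}" for K
  have E_sets [measurable]: "E K \<in> sets paintbox" for K unfolding E_def by measurable
  have "incseq E" unfolding E_def incseq_def by (auto intro: order_trans)
  then have "(\<lambda>K. measure paintbox (E K)) \<longlonglongrightarrow> measure paintbox (\<Union>K. E K)"
    by (intro P.finite_Lim_measure_incseq) auto
  moreover have "measure paintbox (E K) \<le> prob {w\<in>space M. Q (f N w)}" for K
    using prob_truncated_painted_alloc[of Q N K] unfolding E_def[symmetric]
    by (simp add: P.emeasure_eq_measure)
  ultimately have "measure paintbox (\<Union>K. E K) \<le> prob {w\<in>space M. Q (f N w)}"
    by (intro LIMSEQ_le_const2) auto
  moreover have "measure paintbox (\<Union>K. E K) = measure paintbox {p\<in>space paintbox. Q (painted_alloc N p)}"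
  proof (rule P.finite_measure_eq_AE)
    show "AE p in paintbox. p \<in> (\<Union>K. E K) \<longleftrightarrow> p \<in> {p\<in>space paintbox. Q (painted_alloc N p)}"
      using AE_pick_pos
    proof eventually_elim
      case (elim p)
      obtain K where "\<forall>l\<in>{1..N}. pick (fst p) (snd p l) \<le> K"
        using ex_bound[of N "\<lambda>l. pick (fst p) (snd p l)"] by blast
      then have "\<forall>l\<in>{1..N}. 1 \<le> pick (fst p) (snd p l) \<and> pick (fst p) (snd p l) \<le> K" using elim by blast
      then show ?case by (auto simp: E_def)
    qed
  qed measurable
  ultimately show ?thesis by simp
qed

text \<open>The inequality above also holds for the negation of \<open>Q\<close>, and both sides are probabilities.\<close>
lemma prob_painted_alloc:
  "measure paintbox {p\<in>space paintbox. Q (painted_alloc N p)} = prob {w\<in>space M. Q (f N w)}"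
proof (rule antisym)
  interpret P: prob_space paintbox by (rule prob_space_paintbox)
  show "prob {w\<in>space M. Q (f N w)} \<le> measure paintbox {p\<in>space paintbox. Q (painted_alloc N p)}"
    using prob_painted_alloc_le[of "\<lambda>x. \<not> Q x" N]
      P.prob_neg[of "\<lambda>p. Q (painted_alloc N p)"] prob_neg[of "\<lambda>w. Q (f N w)"]
      measurable_via_f[of "\<lambda>w. Q (f N w)" Q N]
    by (simp add: pred_def)
qed (rule prob_painted_alloc_le)


section \<open>Independence in the paintbox\<close>

lemma draws_distr: "distr paintbox draws snd = draws"
proof -
  interpret D: prob_space draws by (rule prob_space_draws)
  show ?thesis
  proof (rule measure_eqI)
    fix A assume "A \<in> sets (distr paintbox draws snd)"
    then have A: "A \<in> sets draws" by simp
    have "snd -` A \<inter> space paintbox = space M \<times> A"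
      using sets.sets_into_space[OF A] by (auto simp: paintbox_def space_pair_measure)
    then show "emeasure (distr paintbox draws snd) A = emeasure draws A"
      using A by (simp add: emeasure_distr paintbox_def D.emeasure_pair_measure_Times emeasure_space_1)
  qed simp
qed

lemma draw_distr: "distr paintbox borel (\<lambda>p. snd p n) = unif"
proof -
  have "distr paintbox borel (\<lambda>p. snd p n) = distr (distr paintbox draws snd) borel (\<lambda>u. u n)"
    by (subst distr_distr) (auto simp: o_def)
  also have "\<dots> = distr draws unif (\<lambda>u. u n)"
    unfolding draws_distr by (rule distr_cong) auto
  also have "\<dots> = unif" unfolding draws_def by (rule draws.PiM_component) simp
  finally show ?thesis .
qed

lemma iid_uniform_paintbox: "iid_uniform paintbox (\<lambda>n p. snd p n)"
  unfolding iid_uniform_def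
proof (intro conjI allI impI)
  interpret P: prob_space paintbox by (rule prob_space_paintbox)
  show "distr paintbox borel (\<lambda>p. snd p n) = uniform_measure lborel {0..1}" for n
    by (simp add: draw_distr unif_def)
  have "distr paintbox (PiM {1..} (\<lambda>_. borel)) (\<lambda>p. \<lambda>n\<in>{1..}. snd p n) =
      distr (distr paintbox draws snd) (PiM {1..} (\<lambda>_. borel)) (\<lambda>u. \<lambda>n\<in>{1..}. u n)"
    by (subst distr_distr) (auto simp: o_def)
  also have "\<dots> = distr (PiM UNIV (\<lambda>_. unif)) (PiM {1..} (\<lambda>_. unif)) (\<lambda>u. \<lambda>n\<in>{1..}. u n)"
    unfolding draws_distr by (rule distr_cong) (auto simp: draws_def intro!: sets_PiM_cong)
  also have "\<dots> = PiM {1..} (\<lambda>_. unif)"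
    by (rule distr_PiM_reindex[of UNIV "\<lambda>_. unif" "\<lambda>n. n" "{1..}"]) (simp_all add: prob_space_unif)
  finally show "P.indep_vars (\<lambda>_. borel) (\<lambda>n p. snd p n) {1..}"
    by (subst P.indep_vars_iff_distr_eq_PiM') (auto simp: draw_distr)
qed

text \<open>The sets \<open>paint k\<close> depend on the first coordinate only, the draws on the second.\<close>
lemma paint_independent: "random_sets_indep paintbox (\<lambda>k p. paint k (fst p)) (\<lambda>n p. snd p n)"
proof -
  interpret P: prob_space paintbox by (rule prob_space_paintbox)
  interpret D: prob_space draws by (rule prob_space_draws)
  define G where "G = vimage_algebra (space paintbox) fst M"
  have fst_sp: "fst \<in> space paintbox \<rightarrow> space M"
    by (auto simp: paintbox_def space_pair_measure)
  have sets_G: "sets G = {fst -` A \<inter> space paintbox |A. A \<in> sets M}"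
    unfolding G_def using fst_sp by (rule sets_vimage_algebra2)
  have space_G: "space G = space paintbox" by (simp add: G_def)
  have "subalgebra paintbox G"
    unfolding subalgebra_def sets_G space_G by auto
  moreover have "{(w, x). w \<in> space G \<and> x \<in> paint k (fst w)} \<in> sets (G \<Otimes>\<^sub>M borel)" for k
  proof -
    have fstG [measurable]: "fst \<in> measurable G M"
      unfolding G_def using fst_sp by (rule measurable_vimage_algebra1)
    have [measurable]: "(\<lambda>q. pick (fst (fst q)) (snd q)) \<in> measurable (G \<Otimes>\<^sub>M borel) (count_space UNIV)"
      by (rule pick_measurable) measurable
    have [measurable]: "Measurable.pred (G \<Otimes>\<^sub>M borel) (\<lambda>q. k \<in> Z j (fst (fst q)))" for j
      by (rule measurable_compose[OF _ pred_Z_f[of "\<lambda>z. k \<in> z"]]) measurable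
    have "{(w, x). w \<in> space G \<and> x \<in> paint k (fst w)} =
       {q\<in>space (G \<Otimes>\<^sub>M borel). \<exists>j. pick (fst (fst q)) (snd q) = j \<and> k \<in> Z j (fst (fst q))}"
      by (auto simp: paint_iff space_pair_measure)
    also have "\<dots> \<in> sets (G \<Otimes>\<^sub>M borel)" by measurable
    finally show ?thesis .
  qed
  moreover have "P.indep_set (sets G)
     (sets (vimage_algebra (space paintbox) (\<lambda>p. \<lambda>n\<in>{1..}. snd p n) (PiM {1..} (\<lambda>_. borel))))"
  proof (rule P.indep_setI)
    let ?r = "\<lambda>u :: nat \<Rightarrow> real. \<lambda>n\<in>{1..}. u n"
    let ?V = "vimage_algebra (space paintbox) (\<lambda>p. ?r (snd p)) (PiM {1..} (\<lambda>_. borel))"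
    have r: "?r \<in> measurable draws (PiM {1..} (\<lambda>_. borel))" by measurable
    have sets_V: "sets ?V = {(\<lambda>p. ?r (snd p)) -` B \<inter> space paintbox |B. B \<in> sets (PiM {1..} (\<lambda>_. borel))}"
      by (rule sets_vimage_algebra2) (auto simp: space_PiM)
    show "sets G \<subseteq> sets paintbox" unfolding sets_G by auto
    show "sets ?V \<subseteq> sets paintbox" unfolding sets_V by (auto intro!: measurable_sets)
    fix a b assume "a \<in> sets G" "b \<in> sets ?V"
    then obtain A B where A: "A \<in> sets M" "a = fst -` A \<inter> space paintbox"
      and B: "B \<in> sets (PiM {1..} (\<lambda>_. borel))" "b = (\<lambda>p. ?r (snd p)) -` B \<inter> space paintbox"
      unfolding sets_G sets_V by blast
    define B' where "B' = ?r -` B \<inter> space draws"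
    have B': "B' \<in> sets draws" unfolding B'_def using r B(1) by (rule measurable_sets)
    have times: "measure paintbox (X \<times> Y) = prob X * measure draws Y"
      if "X \<in> sets M" "Y \<in> sets draws" for X Y
      unfolding paintbox_def measure_def using that
      by (simp add: D.emeasure_pair_measure_Times enn2real_mult)
    have "a = A \<times> space draws"
      using sets.sets_into_space[OF A(1)] by (auto simp: A(2) paintbox_def space_pair_measure)
    moreover have "b = space M \<times> B'"
      by (auto simp: B(2) B'_def paintbox_def space_pair_measure)
    moreover have "a \<inter> b = A \<times> B'"
      using sets.sets_into_space[OF A(1)] calculation by (auto simp: B'_def)
    ultimately show "measure paintbox (a \<inter> b) = measure paintbox a * measure paintbox b"
      using A(1) B' by (simp only: times sets.top prob_space D.prob_space mult_1 mult_1_right)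
  qed
  ultimately show ?thesis unfolding random_sets_indep_def by (intro exI[of _ G]) blast
qed

lemma label_set_paint:
  "label_set (\<lambda>k p. paint k (fst p)) (\<lambda>n p. snd p n) p = (\<lambda>l. Z (pick (fst p) (snd p l)) (fst p))"
  by (auto simp: fun_eq_iff label_set_def paint_iff labels_def)

lemma painted_alloc_eq_alloc_of_label_set:
  "painted_alloc N p = alloc_of (label_set (\<lambda>k p. paint k (fst p)) (\<lambda>n p. snd p n) p) N"
  unfolding label_set_paint painted_alloc_def ..

lemma random_feature_allocation_painted: "random_feature_allocation paintbox painted_alloc"
  unfolding random_feature_allocation_def
proof (intro conjI allI impI)
  fix n :: nat
  show "painted_alloc n \<in> measurable paintbox (count_space (feature_allocations n))"
  proof (rule measurableI)
    fix p show "painted_alloc n p \<in> space (count_space (feature_allocations n))"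
      by (simp add: painted_alloc_def alloc_of_mem)
  next
    fix S
    have "{p\<in>space paintbox. painted_alloc n p \<in> S} \<in> sets paintbox" by measurable
    then show "painted_alloc n -` S \<inter> space paintbox \<in> sets paintbox"
      by (simp add: vimage_def Int_def conj_commute)
  qed
next
  fix m n :: nat assume "1 \<le> m \<and> m < n"
  then show "AE w in paintbox. painted_alloc m w = restrict_alloc m (painted_alloc n w)"
    unfolding painted_alloc_def by (intro AE_I2 restrict_alloc_of[symmetric]) auto
qed

end

section \<open>From single levels to the law of the sequence\<close>

text \<open>By consistency, a cylinder event is almost surely an event at one level.\<close>
lemma cylinder_law:
  assumes "prob_space M" and rfa: "random_feature_allocation M F"
    and J: "finite J" "J \<subseteq> {1..}" and N: "1 \<le> N" "\<And>j. j \<in> J \<Longrightarrow> j \<le> N"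
    and A: "\<And>j. j \<in> J \<Longrightarrow> A j \<subseteq> feature_allocations j"
  shows "emeasure (alloc_law M F) (prod_emb {1..} (\<lambda>n. count_space (feature_allocations n)) J (Pi\<^sub>E J A)) =
    ennreal (measure M {w\<in>space M. \<forall>j\<in>J. restrict_alloc j (F N w) \<in> A j})"
proof -
  interpret prob_space M by fact
  have F: "F n \<in> measurable M (count_space (feature_allocations n))" if "1 \<le> n" for n
    using rfa that by (auto simp: random_feature_allocation_def)
  have F_mem: "F n w \<in> feature_allocations n" if "1 \<le> n" "w \<in> space M" for n w
    using measurable_space[OF F[OF that(1)] that(2)] by simp
  have meas: "(\<lambda>w. \<lambda>n\<in>{1..}. F n w) \<in> measurable M (PiM {1..} (\<lambda>n. count_space (feature_allocations n)))"
    by (rule measurable_restrict) (use F in auto)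
  have emb: "prod_emb {1..} (\<lambda>n. count_space (feature_allocations n)) J (Pi\<^sub>E J A)
      \<in> sets (PiM {1..} (\<lambda>n. count_space (feature_allocations n)))"
    using J A by (intro sets_PiM_I) auto
  have pre: "(\<lambda>w. \<lambda>n\<in>{1..}. F n w) -` prod_emb {1..} (\<lambda>n. count_space (feature_allocations n)) J (Pi\<^sub>E J A) \<inter> space M
     = {w\<in>space M. \<forall>j\<in>J. F j w \<in> A j}"
    using J F_mem by (auto simp: prod_emb_def PiE_iff subset_iff)
  have consistent: "AE w in M. \<forall>j\<in>J. F j w = restrict_alloc j (F N w)"
  proof (rule AE_finite_allI[OF J(1)])
    fix j assume j: "j \<in> J"
    show "AE w in M. F j w = restrict_alloc j (F N w)"
    proof (cases "j = N")
      case True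
      have "restrict_alloc N x = x" if "x \<in> feature_allocations N" for x
      proof -
        have "image_mset (\<lambda>A. A \<inter> {1..N}) x = x"
          using that by (intro multiset.map_ident_strong) (auto simp: feature_allocations_def)
        then show ?thesis
          using that by (simp add: restrict_alloc_def feature_allocations_def filter_mset_eq_conv)
      qed
      then show ?thesis using F_mem[OF N(1)] True by auto
    next
      case False
      then have "1 \<le> j \<and> j < N" using N(2)[OF j] j J by auto
      then show ?thesis using rfa by (auto simp: random_feature_allocation_def)
    qed
  qed
  have sets1: "{w\<in>space M. \<forall>j\<in>J. F j w \<in> A j} \<in> sets M"
    using measurable_sets[OF meas emb] unfolding pre .
  have sets2: "{w\<in>space M. \<forall>j\<in>J. restrict_alloc j (F N w) \<in> A j} \<in> sets M"
  proof -
    have "Measurable.pred M (\<lambda>w. \<forall>j\<in>J. restrict_alloc j (F N w) \<in> A j)"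
      by (rule measurable_compose[OF F[OF N(1)]]) simp
    then show ?thesis by (simp add: pred_def)
  qed
  have "measure M {w\<in>space M. \<forall>j\<in>J. F j w \<in> A j} = measure M {w\<in>space M. \<forall>j\<in>J. restrict_alloc j (F N w) \<in> A j}"
    by (rule finite_measure_eq_AE[OF _ sets1 sets2]) (use consistent in \<open>eventually_elim, auto\<close>)
  then show ?thesis
    unfolding alloc_law_def emeasure_distr[OF meas emb] pre by (simp add: emeasure_eq_measure)
qed

lemma alloc_law_eqI:
  assumes M: "prob_space M" "random_feature_allocation M F"
    and M': "prob_space M'" "random_feature_allocation M' F'"
    and eq: "\<And>N S. 1 \<le> N \<Longrightarrow> measure M {w\<in>space M. F N w \<in> S} = measure M' {w\<in>space M'. F' N w \<in> S}"
  shows "alloc_law M F = alloc_law M' F'"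
proof (rule measure_eqI_PiM_infinite)
  let ?M = "\<lambda>n. count_space (feature_allocations n)"
  show "sets (alloc_law M F) = sets (PiM {1..} ?M)" "sets (alloc_law M' F') = sets (PiM {1..} ?M)"
    by (simp_all add: alloc_law_def)
  have "(\<lambda>w. \<lambda>n\<in>{1..}. F n w) \<in> measurable M (PiM {1..} ?M)"
    by (rule measurable_restrict) (use M(2) in \<open>auto simp: random_feature_allocation_def\<close>)
  then show "finite_measure (alloc_law M F)"
    unfolding alloc_law_def using prob_space.prob_space_distr[OF M(1)] prob_space_def by blast
  fix A and J :: "nat set"
  assume J: "finite J" "J \<subseteq> {1..}" and A: "\<And>j. j \<in> J \<Longrightarrow> A j \<in> sets (?M j)"
  define N where "N = Max (insert 1 J)"
  have N: "1 \<le> N" "\<And>j. j \<in> J \<Longrightarrow> j \<le> N" using J by (auto simp: N_def)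
  have "{w\<in>space M. F N w \<in> {x. \<forall>j\<in>J. restrict_alloc j x \<in> A j}} = {w\<in>space M. \<forall>j\<in>J. restrict_alloc j (F N w) \<in> A j}"
    "{w\<in>space M'. F' N w \<in> {x. \<forall>j\<in>J. restrict_alloc j x \<in> A j}} = {w\<in>space M'. \<forall>j\<in>J. restrict_alloc j (F' N w) \<in> A j}"
    by auto
  then show "emeasure (alloc_law M F) (prod_emb {1..} ?M J (Pi\<^sub>E J A)) =
      emeasure (alloc_law M' F') (prod_emb {1..} ?M J (Pi\<^sub>E J A))"
    using cylinder_law[OF M J N, of A] cylinder_law[OF M' J N, of A] A
      eq[OF N(1), of "{x. \<forall>j\<in>J. restrict_alloc j x \<in> A j}"] by simp
qed

text \<open>
  Consistency holds everywhere after replacing the allocations by empty ones on a null set. Level 0,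
  about which the hypotheses say nothing, is the empty allocation as well.
\<close>
lemma consistent_version:
  assumes "prob_space M" and rfa: "random_feature_allocation M F"
    and exch: "exchangeable M F" and reg: "regular_alloc M F"
  obtains f where "exchangeable_allocation M f" "\<And>n. 1 \<le> n \<Longrightarrow> AE w in M. f n w = F n w"
proof -
  interpret prob_space M by fact
  have F: "F n \<in> measurable M (count_space (feature_allocations n))" if "1 \<le> n" for n
    using rfa that by (auto simp: random_feature_allocation_def)
  have F_mem: "F n w \<in> feature_allocations n" if "1 \<le> n" "w \<in> space M" for n w
    using measurable_space[OF F[OF that(1)] that(2)] by simp
  have "AE w in M. \<forall>n\<ge>1. F n w = restrict_alloc n (F (Suc n) w)"
    unfolding AE_all_countable using rfa by (auto simp: random_feature_allocation_def)
  then obtain B where B: "{w\<in>space M. \<not> (\<forall>n\<ge>1. F n w = restrict_alloc n (F (Suc n) w))} \<subseteq> B"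
    "B \<in> sets M" "emeasure M B = 0" by (rule AE_E)
  define f where "f n w = (if n = 0 \<or> w \<in> B then {#} else F n w)" for n w
  have "AE w in M. w \<notin> B" using B by (intro AE_not_in null_setsI)
  then have f_F: "AE w in M. f n w = F n w" if "1 \<le> n" for n
    using that by (auto simp: f_def elim: eventually_mono)
  have f_meas: "f n \<in> measurable M (count_space UNIV)" for n
  proof (cases "n = 0")
    case False
    then have [measurable]: "F n \<in> measurable M (count_space UNIV)"
      using measurable_compose[OF F[of n], of "\<lambda>x. x" "count_space UNIV"] by simp
    have [measurable]: "Measurable.pred M (\<lambda>w. w \<in> B)" using B(2) by (simp add: pred_sets2)
    have "f n = (\<lambda>w. if w \<in> B then {#} else F n w)" using False by (auto simp: f_def)
    then show ?thesis by simp
  next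
    case True
    then have "f n = (\<lambda>_. {#})" by (auto simp: f_def)
    then show ?thesis by simp
  qed
  have "exchangeable_allocation M f"
  proof unfold_locales
    fix n w assume w: "w \<in> space M"
    show "f n w \<in> feature_allocations n"
      using F_mem[of n w] w by (auto simp: f_def feature_allocations_def)
    show "restrict_alloc n (f (Suc n) w) = f n w"
    proof (cases "n = 0 \<or> w \<in> B")
      case True
      then show ?thesis
        using feature_allocations_0[OF restrict_alloc_mem[of 0 "F (Suc 0) w"]] by (auto simp: f_def restrict_alloc_def)
    next
      case False
      then have "1 \<le> n" by simp
      then have "F n w = restrict_alloc n (F (Suc n) w)" using B(1) w False by blast
      then show ?thesis using False by (simp add: f_def)
    qed
  next
    show "f n \<in> measurable M (count_space UNIV)" for n by (rule f_meas)
  next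
    fix \<sigma> n S assume \<sigma>: "\<sigma> permutes {1..n::nat}"
    have pf: "Measurable.pred M (\<lambda>w. Q (f n w))" for Q
      by (rule measurable_compose[OF f_meas]) simp
    show "prob {w\<in>space M. image_mset ((`) \<sigma>) (f n w) \<in> S} = prob {w\<in>space M. f n w \<in> S}"
    proof (cases "n = 0")
      case False
      then have n: "1 \<le> n" by simp
      let ?C = "count_space (feature_allocations n)"
      have act: "image_mset ((`) \<sigma>) x \<in> feature_allocations n" if "x \<in> feature_allocations n" for x
        using that permutes_image[OF \<sigma>] by (auto simp: feature_allocations_def)
      have m2: "(\<lambda>w. image_mset ((`) \<sigma>) (F n w)) \<in> measurable M ?C"
        by (rule measurable_compose[OF F[OF n]]) (use act in simp)
      have "prob {w\<in>space M. f n w \<in> S} = prob {w\<in>space M. F n w \<in> S \<inter> feature_allocations n}"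
      proof (rule finite_measure_eq_AE)
        show "AE w in M. w \<in> {w\<in>space M. f n w \<in> S} \<longleftrightarrow> w \<in> {w\<in>space M. F n w \<in> S \<inter> feature_allocations n}"
          using f_F[OF n] AE_space by eventually_elim (use F_mem n in auto)
        show "{w\<in>space M. f n w \<in> S} \<in> sets M" using pf by (simp add: pred_def)
        show "{w\<in>space M. F n w \<in> S \<inter> feature_allocations n} \<in> sets M"
          unfolding pred_def[symmetric] by (rule measurable_compose[OF F[OF n]]) simp
      qed
      also have "\<dots> = measure (distr M ?C (F n)) (S \<inter> feature_allocations n)"
        using F[OF n] by (subst measure_distr) (auto intro!: arg_cong[of _ _ prob])
      also have "\<dots> = measure (distr M ?C (\<lambda>w. image_mset ((`) \<sigma>) (F n w))) (S \<inter> feature_allocations n)"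
        using exch n \<sigma> by (simp add: exchangeable_def)
      also have "\<dots> = prob {w\<in>space M. image_mset ((`) \<sigma>) (F n w) \<in> S \<inter> feature_allocations n}"
        using m2 by (subst measure_distr) (auto intro!: arg_cong[of _ _ prob])
      also have "\<dots> = prob {w\<in>space M. image_mset ((`) \<sigma>) (f n w) \<in> S}"
      proof (rule finite_measure_eq_AE)
        show "AE w in M. w \<in> {w\<in>space M. image_mset ((`) \<sigma>) (F n w) \<in> S \<inter> feature_allocations n}
            \<longleftrightarrow> w \<in> {w\<in>space M. image_mset ((`) \<sigma>) (f n w) \<in> S}"
          using f_F[OF n] AE_space by eventually_elim (use F_mem n act in auto)
        show "{w\<in>space M. image_mset ((`) \<sigma>) (f n w) \<in> S} \<in> sets M"
          using pf[of "\<lambda>x. image_mset ((`) \<sigma>) x \<in> S"] by (simp add: pred_def)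
        show "{w\<in>space M. image_mset ((`) \<sigma>) (F n w) \<in> S \<inter> feature_allocations n} \<in> sets M"
          unfolding pred_def[symmetric] by (rule measurable_compose[OF m2]) simp
      qed
      finally show ?thesis ..
    qed (simp add: f_def)
  next
    have "AE w in M. \<forall>n\<ge>1. f n w = F n w"
      unfolding AE_all_countable using f_F by auto
    moreover have "AE w in M. \<exists>g. represents g (\<lambda>j. F j w) \<and> (\<exists>m\<ge>1. m \<noteq> 1 \<and> features_of g m = features_of g 1)"
      using reg unfolding regular_alloc_def by blast
    ultimately show "AE w in M. \<exists>m\<ge>2. alike (f m w) 1 m"
    proof eventually_elim
      case (elim w)
      then obtain g m where g: "represents g (\<lambda>j. F j w)" "m \<ge> 1" "m \<noteq> 1" "features_of g 1 = features_of g m"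
        by metis
      then have "alike (F m w) 1 m" using alike_if_same_features[OF g(1,4), of m] by simp
      then have "alike (f m w) 1 m" "m \<ge> 2" using elim g by auto
      then show ?case by blast
    qed
  qed
  then show ?thesis using f_F by (rule that)
qed

theorem mainTheorem1:
  fixes M :: "'w measure" and F :: "nat \<Rightarrow> 'w \<Rightarrow> nat set multiset"
  assumes "prob_space M"
    and "random_feature_allocation M F"
    and "exchangeable M F"
    and "regular_alloc M F"
  shows "\<exists>(M' :: ('w \<times> (nat \<Rightarrow> real)) measure) (C :: nat \<Rightarrow> 'w \<times> (nat \<Rightarrow> real) \<Rightarrow> real set)
            (U :: nat \<Rightarrow> 'w \<times> (nat \<Rightarrow> real) \<Rightarrow> real)
            (F' :: nat \<Rightarrow> 'w \<times> (nat \<Rightarrow> real) \<Rightarrow> nat set multiset).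
           prob_space M' \<and>
           (\<forall>k\<ge>1. \<forall>w\<in>space M'. countable_union_of_intervals (C k w)) \<and>
           iid_uniform M' U \<and>
           random_sets_indep M' C U \<and>
           random_feature_allocation M' F' \<and>
           (AE w in M'. (\<forall>n\<ge>1. finite (label_set C U w n)) \<and>
              represents (induced_alloc (label_set C U w)) (\<lambda>n. F' n w)) \<and>
           alloc_law M F = alloc_law M' F'"
proof -
  obtain f where "exchangeable_allocation M f" and f: "\<And>n. 1 \<le> n \<Longrightarrow> AE w in M. f n w = F n w"
    using consistent_version[OF assms] by blast
  then interpret exchangeable_allocation M f by simp
  let ?C = "\<lambda>k p. paint k (fst p)" and ?U = "\<lambda>n p. snd p n"
  have fin: "finite (label_set ?C ?U p n)" for p n
    unfolding label_set_paint by simp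
  have rep: "represents (induced_alloc (label_set ?C ?U p)) (\<lambda>n. painted_alloc n p)" for p
    unfolding painted_alloc_eq_alloc_of_label_set
    by (rule represents_induced_alloc) (auto simp: fin, simp add: label_set_def)
  have "alloc_law M F = alloc_law paintbox painted_alloc"
  proof (rule alloc_law_eqI[OF assms(1,2) prob_space_paintbox random_feature_allocation_painted])
    fix N :: nat and S assume N: "1 \<le> N"
    have "F N \<in> measurable M (count_space (feature_allocations N))"
      using assms(2) N by (auto simp: random_feature_allocation_def)
    then have "Measurable.pred M (\<lambda>w. F N w \<in> S)"
      by (rule measurable_compose) simp
    moreover have "Measurable.pred M (\<lambda>w. f N w \<in> S)"
      by (rule measurable_via_f) simp
    ultimately have "measure M {w\<in>space M. F N w \<in> S} = measure M {w\<in>space M. f N w \<in> S}"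
      unfolding pred_def
      by (intro finite_measure_eq_AE) (use f[OF N] in \<open>eventually_elim, auto\<close>)
    then show "measure M {w\<in>space M. F N w \<in> S} = measure paintbox {p\<in>space paintbox. painted_alloc N p \<in> S}"
      using prob_painted_alloc[of "\<lambda>x. x \<in> S" N] by simp
  qed
  then show ?thesis
    using prob_space_paintbox paint_is_union_of_intervals iid_uniform_paintbox paint_independent
      random_feature_allocation_painted fin rep
    by (intro exI[of _ paintbox] exI[of _ ?C] exI[of _ ?U] exI[of _ painted_alloc]) auto
qed

end
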